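(* Let $A$ and $B$ be rings, let $M$ be an $(A,B)$-bimodule, and let $R=\begin{pmatrix}A & M\\ 0 & B\end{pmatrix}$ be the triangular matrix ring. Let $\sigma:\begin{pmatrix}A\\ 0\end{pmatrix}\to\begin{pmatrix}M\\ B\end{pmatrix}$ be a morphism of left $R$-modules, and let $p\in M$ be the element with $\sigma\begin{pmatrix}1\\ 0\end{pmatrix}=\begin{pmatrix}p\\ 0\end{pmatrix}$. Let $T=T(M,p)$, with structure maps $\rho_A:A\to T$, $\rho_M:M\to T$, $\rho_B:B\to T$. Then the universal localization $R\to\sigma^{-1}R$ is (isomorphic, as a ring under $R$, to) the ring morphism $$R=\begin{pmatrix}A & M\\ 0 & B\end{pmatrix}\xrightarrow{\begin{pmatrix}\rho_A & \rho_M\\ 0 & \rho_B\end{pmatrix}}\begin{pmatrix}T & T\\ T & T\end{pmatrix}=M_2(T).$$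
   Context: All rings are associative with $1$ and ring morphisms preserve $1$. Triangular matrix ring: for rings $A,B$ and an $(A,B)$-bimodule $M$, the ring $R=\begin{pmatrix}A & M\\ 0 & B\end{pmatrix}$ has entrywise addition and multiplication $\begin{pmatrix}a & m\\ 0 & b\end{pmatrix}\begin{pmatrix}a' & m'\\ 0 & b'\end{pmatrix}=\begin{pmatrix}aa' & am'+mb'\\ 0 & bb'\end{pmatrix}$. Its columns $P=\begin{pmatrix}A\\ 0\end{pmatrix}$ and $Q=\begin{pmatrix}M\\ B\end{pmatrix}$ are finitely generated projective left $R$-modules (under matrix multiplication) with $P\oplus Q\cong R$. Every left $R$-module morphism $\sigma:P\to Q$ satisfies $\sigma\begin{pmatrix}1\\ 0\end{pmatrix}=\begin{pmatrix}p\\ 0\end{pmatrix}$ for some $p\in M$. Universal localization: a ring morphism $R\to R'$ is $\sigma$-inverting if $\mathrm{id}\otimes\sigma:R'\otimes_R P\to R'\otimes_R Q$ is an isomorphism. The universal localization $R\to\sigma^{-1}R$ is the initial object in the category of $\sigma$-inverting ring morphisms $R\to R'$, i.e. it is $\sigma$-inverting and every $\sigma$-inverting ring morphism $R\to R'$ factors uniquely as $R\to\sigma^{-1}R\to R'$. $(A,M,B)$-rings: an $(A,M,B)$-ring $(S,f_A,f_M,f_B)$ is a ring $S$ with ring morphisms $f_A:A\to S$, $f_B:B\to S$ and an $(A,B)$-bimodule morphism $f_M:M\to S$, where $S$ is an $(A,B)$-bimodule via $f_A,f_B$ (so $f_M$ is additive, $f_A(a)f_M(m)=f_M(am)$ and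 $f_M(m)f_B(b)=f_M(mb)$). A morphism $(S,f_A,f_M,f_B)\to(S',f'_A,f'_M,f'_B)$ is a ring morphism $\theta:S\to S'$ with $\theta f_A=f'_A$, $\theta f_M=f'_M$, $\theta f_B=f'_B$. For $p\in M$, $(T(M,p),\rho_A,\rho_M,\rho_B)$ is the initial object in the category of those $(A,M,B)$-rings $(S,f_A,f_M,f_B)$ with $f_M(p)=1$. Explicitly, $T(M,p)$ is the ring with one generator $x_m$ for each $m\in M$ and relations $x_m+x_{m'}=x_{m+m'}$, $x_{ap}x_m=x_{am}$, $x_mx_{pb}=x_{mb}$, $x_p=1$ for all $m,m'\in M$, $a\in A$, $b\in B$; and $\rho_A(a)=x_{ap}$, $\rho_B(b)=x_{pb}$, $\rho_M(m)=x_m$. *)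

theory Defs
  imports "HOL-Algebra.Module" "HOL-Algebra.QuotRing" "HOL-Algebra.Generated_Groups"
    "HOL-Algebra.Free_Abelian_Groups"
begin

section \<open>Left modules and bimodules over (not necessarily commutative) rings\<close>

text \<open>
  The locale \<open>module\<close> of HOL-Algebra requires a commutative ring of scalars; the record type
  \<open>module\<close> is reused here. Its fields \<open>mult\<close> and \<open>one\<close> play no role for a module.
\<close>

locale left_module = R?: ring R + M?: abelian_group M
  for R :: "('r, 'x) ring_scheme" (structure)
    and M :: "('r, 'm, 'z) module_scheme" (structure) +
  assumes lsmult_closed:
      "\<lbrakk>r \<in> carrier R; x \<in> carrier M\<rbrakk> \<Longrightarrow> r \<odot>\<^bsub>M\<^esub> x \<in> carrier M"
    and lsmult_l_distr:
      "\<lbrakk>r \<in> carrier R; s \<in> carrier R; x \<in> carrier M\<rbrakk> \<Longrightarrow>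
        (r \<oplus>\<^bsub>R\<^esub> s) \<odot>\<^bsub>M\<^esub> x = r \<odot>\<^bsub>M\<^esub> x \<oplus>\<^bsub>M\<^esub> s \<odot>\<^bsub>M\<^esub> x"
    and lsmult_r_distr:
      "\<lbrakk>r \<in> carrier R; x \<in> carrier M; y \<in> carrier M\<rbrakk> \<Longrightarrow>
        r \<odot>\<^bsub>M\<^esub> (x \<oplus>\<^bsub>M\<^esub> y) = r \<odot>\<^bsub>M\<^esub> x \<oplus>\<^bsub>M\<^esub> r \<odot>\<^bsub>M\<^esub> y"
    and lsmult_assoc:
      "\<lbrakk>r \<in> carrier R; s \<in> carrier R; x \<in> carrier M\<rbrakk> \<Longrightarrow>
        (r \<otimes>\<^bsub>R\<^esub> s) \<odot>\<^bsub>M\<^esub> x = r \<odot>\<^bsub>M\<^esub> (s \<odot>\<^bsub>M\<^esub> x)"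
    and lsmult_one:
      "x \<in> carrier M \<Longrightarrow> \<one>\<^bsub>R\<^esub> \<odot>\<^bsub>M\<^esub> x = x"

definition left_module_hom ::
  "('r, 'x) ring_scheme \<Rightarrow> ('r, 'm, 'y) module_scheme \<Rightarrow> ('r, 'n, 'z) module_scheme \<Rightarrow> ('m \<Rightarrow> 'n) set"
  where "left_module_hom R M N =
    {h. h \<in> carrier M \<rightarrow> carrier N \<and>
        (\<forall>x\<in>carrier M. \<forall>y\<in>carrier M. h (x \<oplus>\<^bsub>M\<^esub> y) = h x \<oplus>\<^bsub>N\<^esub> h y) \<and>
        (\<forall>r\<in>carrier R. \<forall>x\<in>carrier M. h (r \<odot>\<^bsub>M\<^esub> x) = r \<odot>\<^bsub>N\<^esub> h x)}"

definition left_module_iso ::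
  "('r, 'x) ring_scheme \<Rightarrow> ('r, 'm, 'y) module_scheme \<Rightarrow> ('r, 'n, 'z) module_scheme \<Rightarrow> ('m \<Rightarrow> 'n) set"
  where "left_module_iso R M N =
    {h \<in> left_module_hom R M N. bij_betw h (carrier M) (carrier N)}"

record ('a, 'b, 'm) bimodule = "('a, 'm) module" +
  rsmult :: "'m \<Rightarrow> 'b \<Rightarrow> 'm" (infixl \<open>\<triangleleft>\<index>\<close> 70)

locale bimodule = left_module A M + B?: ring B
  for A :: "('a, 'x) ring_scheme" (structure)
    and B :: "('b, 'y) ring_scheme" (structure)
    and M :: "('a, 'b, 'm, 'z) bimodule_scheme" (structure) +
  assumes rsmult_closed:
      "\<lbrakk>x \<in> carrier M; b \<in> carrier B\<rbrakk> \<Longrightarrow> x \<triangleleft>\<^bsub>M\<^esub> b \<in> carrier M"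
    and rsmult_l_distr:
      "\<lbrakk>x \<in> carrier M; y \<in> carrier M; b \<in> carrier B\<rbrakk> \<Longrightarrow>
        (x \<oplus>\<^bsub>M\<^esub> y) \<triangleleft>\<^bsub>M\<^esub> b = x \<triangleleft>\<^bsub>M\<^esub> b \<oplus>\<^bsub>M\<^esub> y \<triangleleft>\<^bsub>M\<^esub> b"
    and rsmult_r_distr:
      "\<lbrakk>x \<in> carrier M; b \<in> carrier B; c \<in> carrier B\<rbrakk> \<Longrightarrow>
        x \<triangleleft>\<^bsub>M\<^esub> (b \<oplus>\<^bsub>B\<^esub> c) = x \<triangleleft>\<^bsub>M\<^esub> b \<oplus>\<^bsub>M\<^esub> x \<triangleleft>\<^bsub>M\<^esub> c"
    and rsmult_assoc:
      "\<lbrakk>x \<in> carrier M; b \<in> carrier B; c \<in> carrier B\<rbrakk> \<Longrightarrow>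
        x \<triangleleft>\<^bsub>M\<^esub> (b \<otimes>\<^bsub>B\<^esub> c) = (x \<triangleleft>\<^bsub>M\<^esub> b) \<triangleleft>\<^bsub>M\<^esub> c"
    and rsmult_one:
      "x \<in> carrier M \<Longrightarrow> x \<triangleleft>\<^bsub>M\<^esub> \<one>\<^bsub>B\<^esub> = x"
    and smult_rsmult_assoc:
      "\<lbrakk>a \<in> carrier A; x \<in> carrier M; b \<in> carrier B\<rbrakk> \<Longrightarrow>
        (a \<odot>\<^bsub>M\<^esub> x) \<triangleleft>\<^bsub>M\<^esub> b = a \<odot>\<^bsub>M\<^esub> (x \<triangleleft>\<^bsub>M\<^esub> b)"


section \<open>Matrix rings\<close>

text \<open>
  The triple \<open>(a, m, b)\<close> stands for the triangular matrix with rows \<open>(a, m)\<close> and \<open>(0, b)\<close>.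
\<close>

definition triangular_ring ::
  "('a, 'x) ring_scheme \<Rightarrow> ('b, 'y) ring_scheme \<Rightarrow> ('a, 'b, 'm, 'z) bimodule_scheme \<Rightarrow>
    ('a \<times> 'm \<times> 'b) ring"
  where "triangular_ring A B M =
    \<lparr>carrier = carrier A \<times> carrier M \<times> carrier B,
     monoid.mult = (\<lambda>(a, m, b) (a', m', b').
       (a \<otimes>\<^bsub>A\<^esub> a', a \<odot>\<^bsub>M\<^esub> m' \<oplus>\<^bsub>M\<^esub> m \<triangleleft>\<^bsub>M\<^esub> b', b \<otimes>\<^bsub>B\<^esub> b')),
     one = (\<one>\<^bsub>A\<^esub>, \<zero>\<^bsub>M\<^esub>, \<one>\<^bsub>B\<^esub>),
     ring.zero = (\<zero>\<^bsub>A\<^esub>, \<zero>\<^bsub>M\<^esub>, \<zero>\<^bsub>B\<^esub>),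
     ring.add = (\<lambda>(a, m, b) (a', m', b'). (a \<oplus>\<^bsub>A\<^esub> a', m \<oplus>\<^bsub>M\<^esub> m', b \<oplus>\<^bsub>B\<^esub> b'))\<rparr>"

text \<open>
  The two columns as left modules over the triangular ring, with matrix multiplication as the
  action. An element \<open>x\<close> of the first one stands for the column with entries \<open>x\<close>, \<open>0\<close>; an element
  \<open>(m, b)\<close> of the second one for the column with entries \<open>m\<close>, \<open>b\<close>.
\<close>

definition column1 :: "('a, 'x) ring_scheme \<Rightarrow> ('a \<times> 'm \<times> 'b, 'a) module"
  where "column1 A =
    \<lparr>carrier = carrier A, monoid.mult = undefined, one = undefined,
     ring.zero = \<zero>\<^bsub>A\<^esub>, ring.add = (\<lambda>x y. x \<oplus>\<^bsub>A\<^esub> y),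
     smult = (\<lambda>(a, m, b) x. a \<otimes>\<^bsub>A\<^esub> x)\<rparr>"

definition column2 ::
  "('b, 'y) ring_scheme \<Rightarrow> ('a, 'b, 'm, 'z) bimodule_scheme \<Rightarrow> ('a \<times> 'm \<times> 'b, 'm \<times> 'b) module"
  where "column2 B M =
    \<lparr>carrier = carrier M \<times> carrier B, monoid.mult = undefined, one = undefined,
     ring.zero = (\<zero>\<^bsub>M\<^esub>, \<zero>\<^bsub>B\<^esub>), ring.add = (\<lambda>(m, b) (m', b'). (m \<oplus>\<^bsub>M\<^esub> m', b \<oplus>\<^bsub>B\<^esub> b')),
     smult = (\<lambda>(a, m, b) (m', b'). (a \<odot>\<^bsub>M\<^esub> m' \<oplus>\<^bsub>M\<^esub> m \<triangleleft>\<^bsub>M\<^esub> b', b \<otimes>\<^bsub>B\<^esub> b'))\<rparr>"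

text \<open>
  The quadruple \<open>(x, y, z, w)\<close> stands for the matrix with rows \<open>(x, y)\<close> and \<open>(z, w)\<close>.
\<close>

definition matrix2_ring :: "('t, 'x) ring_scheme \<Rightarrow> ('t \<times> 't \<times> 't \<times> 't) ring"
  where "matrix2_ring T =
    \<lparr>carrier = carrier T \<times> carrier T \<times> carrier T \<times> carrier T,
     monoid.mult = (\<lambda>(x, y, z, w) (x', y', z', w').
       (x \<otimes>\<^bsub>T\<^esub> x' \<oplus>\<^bsub>T\<^esub> y \<otimes>\<^bsub>T\<^esub> z', x \<otimes>\<^bsub>T\<^esub> y' \<oplus>\<^bsub>T\<^esub> y \<otimes>\<^bsub>T\<^esub> w',
        z \<otimes>\<^bsub>T\<^esub> x' \<oplus>\<^bsub>T\<^esub> w \<otimes>\<^bsub>T\<^esub> z', z \<otimes>\<^bsub>T\<^esub> y' \<oplus>\<^bsub>T\<^esub> w \<otimes>\<^bsub>T\<^esub> w')),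
     one = (\<one>\<^bsub>T\<^esub>, \<zero>\<^bsub>T\<^esub>, \<zero>\<^bsub>T\<^esub>, \<one>\<^bsub>T\<^esub>),
     ring.zero = (\<zero>\<^bsub>T\<^esub>, \<zero>\<^bsub>T\<^esub>, \<zero>\<^bsub>T\<^esub>, \<zero>\<^bsub>T\<^esub>),
     ring.add = (\<lambda>(x, y, z, w) (x', y', z', w').
       (x \<oplus>\<^bsub>T\<^esub> x', y \<oplus>\<^bsub>T\<^esub> y', z \<oplus>\<^bsub>T\<^esub> z', w \<oplus>\<^bsub>T\<^esub> w'))\<rparr>"


section \<open>Extension of scalars\<close>

text \<open>
  For a ring morphism \<open>g\<close> from \<open>R\<close> to \<open>S\<close> and a left \<open>R\<close>-module \<open>P\<close>, the tensor product of \<open>S\<close>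
  (a right \<open>R\<close>-module via \<open>g\<close>) with \<open>P\<close> over \<open>R\<close>: the free abelian group on the pairs \<open>(s, x)\<close>
  modulo the subgroup \<open>tensor_relations\<close>.
\<close>

definition tensor_free ::
  "('s, 'w) ring_scheme \<Rightarrow> ('r, 'p, 'z) module_scheme \<Rightarrow> ('s \<times> 'p \<Rightarrow>\<^sub>0 int) monoid"
  where "tensor_free S P = free_Abelian_group (carrier S \<times> carrier P)"

definition tensor_relations ::
  "('r, 'x) ring_scheme \<Rightarrow> ('s, 'w) ring_scheme \<Rightarrow> ('r \<Rightarrow> 's) \<Rightarrow> ('r, 'p, 'z) module_scheme \<Rightarrow>
    ('s \<times> 'p \<Rightarrow>\<^sub>0 int) set"
  where "tensor_relations R S g P = generate (tensor_free S P)
    ({frag_of (s \<oplus>\<^bsub>S\<^esub> s', x) - frag_of (s, x) - frag_of (s', x) | s s' x.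
        s \<in> carrier S \<and> s' \<in> carrier S \<and> x \<in> carrier P} \<union>
     {frag_of (s, x \<oplus>\<^bsub>P\<^esub> x') - frag_of (s, x) - frag_of (s, x') | s x x'.
        s \<in> carrier S \<and> x \<in> carrier P \<and> x' \<in> carrier P} \<union>
     {frag_of (s \<otimes>\<^bsub>S\<^esub> g r, x) - frag_of (s, r \<odot>\<^bsub>P\<^esub> x) | s r x.
        s \<in> carrier S \<and> r \<in> carrier R \<and> x \<in> carrier P})"

text \<open>
  The map on cosets induced by the homomorphism of free abelian groups that extends \<open>f\<close>, a
  function from generators to generators. For a coset \<open>C\<close> all the cosets in the union coincide as
  soon as the homomorphism maps the relations of the source into those of the target, \<open>N\<close>.
\<close>

definition tensor_induced ::
  "('s \<times> 'q \<Rightarrow>\<^sub>0 int) monoid \<Rightarrow> ('s \<times> 'q \<Rightarrow>\<^sub>0 int) set \<Rightarrow> ('s \<times> 'p \<Rightarrow> 's \<times> 'q) \<Rightarrow>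
    ('s \<times> 'p \<Rightarrow>\<^sub>0 int) set \<Rightarrow> ('s \<times> 'q \<Rightarrow>\<^sub>0 int) set"
  where "tensor_induced F N f C = (\<Union>c\<in>C. N #>\<^bsub>F\<^esub> frag_extend (\<lambda>i. frag_of (f i)) c)"

definition tensor_module ::
  "('r, 'x) ring_scheme \<Rightarrow> ('s, 'w) ring_scheme \<Rightarrow> ('r \<Rightarrow> 's) \<Rightarrow> ('r, 'p, 'z) module_scheme \<Rightarrow>
    ('s, ('s \<times> 'p \<Rightarrow>\<^sub>0 int) set) module"
  where "tensor_module R S g P =
    (let F = tensor_free S P; N = tensor_relations R S g P in
      \<lparr>carrier = carrier (F Mod N), monoid.mult = undefined, one = undefined,
       ring.zero = \<one>\<^bsub>F Mod N\<^esub>, ring.add = (\<lambda>C D. C \<otimes>\<^bsub>F Mod N\<^esub> D),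
       smult = (\<lambda>s. tensor_induced F N (\<lambda>(t, x). (s \<otimes>\<^bsub>S\<^esub> t, x)))\<rparr>)"

definition tensor_map ::
  "('r, 'x) ring_scheme \<Rightarrow> ('s, 'w) ring_scheme \<Rightarrow> ('r \<Rightarrow> 's) \<Rightarrow> ('r, 'q, 'z) module_scheme \<Rightarrow>
    ('p \<Rightarrow> 'q) \<Rightarrow> ('s \<times> 'p \<Rightarrow>\<^sub>0 int) set \<Rightarrow> ('s \<times> 'q \<Rightarrow>\<^sub>0 int) set"
  where "tensor_map R S g Q \<sigma> =
    tensor_induced (tensor_free S Q) (tensor_relations R S g Q) (\<lambda>(s, x). (s, \<sigma> x))"


section \<open>Universal localization\<close>

definition sigma_inverting ::
  "('r, 'x) ring_scheme \<Rightarrow> ('r, 'p, 'y) module_scheme \<Rightarrow> ('r, 'q, 'z) module_scheme \<Rightarrow> ('p \<Rightarrow> 'q) \<Rightarrow>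
    ('s, 'w) ring_scheme \<Rightarrow> ('r \<Rightarrow> 's) \<Rightarrow> bool"
  where "sigma_inverting R P Q \<sigma> S g \<longleftrightarrow>
    ring S \<and> g \<in> ring_hom R S \<and>
    tensor_map R S g Q \<sigma> \<in> left_module_iso S (tensor_module R S g P) (tensor_module R S g Q)"

text \<open>
  A HOL formula cannot quantify over types, so initiality is expressed relative to a type \<open>'c\<close>
  from which the elements of the test rings \<open>S\<close> are drawn; a theorem in which \<open>'c\<close> is a type
  variable unrelated to the data covers all rings. Restricting the factorization \<open>h\<close> to
  \<open>extensional\<close> functions makes its uniqueness a statement about its values on the carrier only.
\<close>

definition universal_localization ::
  "'c itself \<Rightarrow> ('r, 'x) ring_scheme \<Rightarrow> ('r, 'p, 'y) module_scheme \<Rightarrow> ('r, 'q, 'z) module_scheme \<Rightarrow>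
    ('p \<Rightarrow> 'q) \<Rightarrow> ('l, 'w) ring_scheme \<Rightarrow> ('r \<Rightarrow> 'l) \<Rightarrow> bool"
  where "universal_localization TC R P Q \<sigma> L l \<longleftrightarrow>
    sigma_inverting R P Q \<sigma> L l \<and>
    (\<forall>(S :: 'c ring) g. sigma_inverting R P Q \<sigma> S g \<longrightarrow>
      (\<exists>!h. h \<in> ring_hom L S \<inter> extensional (carrier L) \<and>
            (\<forall>r\<in>carrier R. h (l r) = g r)))"


section \<open>The ring \<open>T(M, p)\<close>\<close>

text \<open>
  The free ring on a set \<open>X\<close>: integral linear combinations of words in \<open>X\<close>, with the bilinear
  extension of concatenation as multiplication.
\<close>

definition free_ring :: "'m set \<Rightarrow> ('m list \<Rightarrow>\<^sub>0 int) ring"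
  where "free_ring X =
    \<lparr>carrier = carrier (free_Abelian_group (lists X)),
     monoid.mult = (\<lambda>u v. frag_extend (\<lambda>xs. frag_extend (\<lambda>ys. frag_of (xs @ ys)) v) u),
     one = frag_of [], ring.zero = 0, ring.add = (+)\<rparr>"

definition T_relations ::
  "('a, 'x) ring_scheme \<Rightarrow> ('b, 'y) ring_scheme \<Rightarrow> ('a, 'b, 'm, 'z) bimodule_scheme \<Rightarrow> 'm \<Rightarrow>
    ('m list \<Rightarrow>\<^sub>0 int) set"
  where "T_relations A B M p =
     {frag_of [m] + frag_of [m'] - frag_of [m \<oplus>\<^bsub>M\<^esub> m'] | m m'.
        m \<in> carrier M \<and> m' \<in> carrier M} \<union>
     {frag_of [a \<odot>\<^bsub>M\<^esub> p] \<otimes>\<^bsub>free_ring (carrier M)\<^esub> frag_of [m] - frag_of [a \<odot>\<^bsub>M\<^esub> m] | a m.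
        a \<in> carrier A \<and> m \<in> carrier M} \<union>
     {frag_of [m] \<otimes>\<^bsub>free_ring (carrier M)\<^esub> frag_of [p \<triangleleft>\<^bsub>M\<^esub> b] - frag_of [m \<triangleleft>\<^bsub>M\<^esub> b] | m b.
        m \<in> carrier M \<and> b \<in> carrier B} \<union>
     {frag_of [p] - \<one>\<^bsub>free_ring (carrier M)\<^esub>}"

definition T_ideal ::
  "('a, 'x) ring_scheme \<Rightarrow> ('b, 'y) ring_scheme \<Rightarrow> ('a, 'b, 'm, 'z) bimodule_scheme \<Rightarrow> 'm \<Rightarrow>
    ('m list \<Rightarrow>\<^sub>0 int) set"
  where "T_ideal A B M p = Idl\<^bsub>free_ring (carrier M)\<^esub> (T_relations A B M p)"

definition T_ring ::
  "('a, 'x) ring_scheme \<Rightarrow> ('b, 'y) ring_scheme \<Rightarrow> ('a, 'b, 'm, 'z) bimodule_scheme \<Rightarrow> 'm \<Rightarrow>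
    ('m list \<Rightarrow>\<^sub>0 int) set ring"
  where "T_ring A B M p = free_ring (carrier M) Quot T_ideal A B M p"

definition rho_M ::
  "('a, 'x) ring_scheme \<Rightarrow> ('b, 'y) ring_scheme \<Rightarrow> ('a, 'b, 'm, 'z) bimodule_scheme \<Rightarrow> 'm \<Rightarrow>
    'm \<Rightarrow> ('m list \<Rightarrow>\<^sub>0 int) set"
  where "rho_M A B M p m = T_ideal A B M p +>\<^bsub>free_ring (carrier M)\<^esub> frag_of [m]"

definition rho_A ::
  "('a, 'x) ring_scheme \<Rightarrow> ('b, 'y) ring_scheme \<Rightarrow> ('a, 'b, 'm, 'z) bimodule_scheme \<Rightarrow> 'm \<Rightarrow>
    'a \<Rightarrow> ('m list \<Rightarrow>\<^sub>0 int) set"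
  where "rho_A A B M p a = rho_M A B M p (a \<odot>\<^bsub>M\<^esub> p)"

definition rho_B ::
  "('a, 'x) ring_scheme \<Rightarrow> ('b, 'y) ring_scheme \<Rightarrow> ('a, 'b, 'm, 'z) bimodule_scheme \<Rightarrow> 'm \<Rightarrow>
    'b \<Rightarrow> ('m list \<Rightarrow>\<^sub>0 int) set"
  where "rho_B A B M p b = rho_M A B M p (p \<triangleleft>\<^bsub>M\<^esub> b)"

definition rho_matrix ::
  "('a, 'x) ring_scheme \<Rightarrow> ('b, 'y) ring_scheme \<Rightarrow> ('a, 'b, 'm, 'z) bimodule_scheme \<Rightarrow> 'm \<Rightarrow>
    'a \<times> 'm \<times> 'b \<Rightarrow>
    ('m list \<Rightarrow>\<^sub>0 int) set \<times> ('m list \<Rightarrow>\<^sub>0 int) set \<times> ('m list \<Rightarrow>\<^sub>0 int) set \<times> ('m list \<Rightarrow>\<^sub>0 int) set"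
  where "rho_matrix A B M p =
    (\<lambda>(a, m, b). (rho_A A B M p a, rho_M A B M p m, \<zero>\<^bsub>T_ring A B M p\<^esub>, rho_B A B M p b))"

end

(*
  Let e and f be the images in S of the two diagonal idempotents of R under a ring morphism g, and
  w the image of the matrix whose only non-zero entry is p. The extended columns are the left
  ideals S e and S f, and the extension of sigma is right multiplication by w, so g inverts sigma
  iff there is u in S with u e = u = f u, w u = e and u w = f. In M_2(T) one takes for u the
  matrix unit at position (2,1). In general, m |-> g(m) u makes the corner ring e S e an
  (A, M, B)-ring sending p to 1, hence gives a morphism theta from T to e S e, and
  (x, y, z, t) |-> theta(x) + theta(y) w + u theta(z) + u theta(t) w is the factorization.
  It is unique since it must send the matrix units to e, w, u, f.
*)
theory Submission
  imports Defs
begin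

text \<open>The elements \<open>w\<close> and \<open>u\<close> make the complementary idempotents
  \<open>e\<close> and \<open>f\<close> equivalent, and a ring with two such idempotents is the ring
  of two-by-two matrices over its corner \<open>e S e\<close>. This forces the shape of the
  localization; what remains is to find the universal corner. There all data come from one function
  on \<open>M\<close>: an element \<open>a\<close> acts as \<open>g(a) = g(a p) u\<close>, while
  \<open>b\<close>, which lives in the corner at \<open>f\<close>, is carried over to
  \<open>w g(b) u = g(p b) u\<close>. This is why the generators \<open>x_m\<close> suffice and why
  the images of \<open>A\<close> and \<open>B\<close> in \<open>T\<close> are read off at
  \<open>a p\<close> and \<open>p b\<close>.

  The obstacle is that the objects are given by presentations: the tensor products are quotients of
  free abelian groups, \<open>T\<close> is a quotient of a free ring. For tensor products
  coordinates help: a column is generated by one vector, so every tensor is pure, and its class is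
  recognized by an element of \<open>S\<close>. For \<open>T\<close>, induction over generators
  takes the place of the uniqueness half of initiality.\<close>

section \<open>Differences in abelian groups and rings\<close>

lemma hom_minus:
  assumes "ring_hom_ring R S h" "x \<in> carrier R" "y \<in> carrier R"
  shows "h (x \<ominus>\<^bsub>R\<^esub> y) = h x \<ominus>\<^bsub>S\<^esub> h y"
proof -
  interpret ring_hom_ring R S h by fact
  show ?thesis
    using assms(2,3) by (simp add: a_minus_def)
qed

lemma (in abelian_group) minus_zero_imp_eq:
  assumes "x \<ominus> y = \<zero>" "x \<in> carrier G" "y \<in> carrier G"
  shows "x = y"
  using assms minus_equality[of x "\<ominus> y"] by (simp add: a_minus_def)

text \<open>This is the shape that the additivity relations of a tensor product take once they are
  evaluated in a ring.\<close>

lemma (in abelian_group) add_minus_minus: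
  assumes "x \<in> carrier G" "y \<in> carrier G"
  shows "x \<oplus> y \<ominus> x \<ominus> y = \<zero>"
proof -
  have "x \<oplus> y \<ominus> x = y"
    using assms by (simp add: a_comm[of x y] a_minus_def a_assoc r_neg)
  with assms show ?thesis
    by (simp add: a_minus_def r_neg)
qed

section \<open>The free ring\<close>

lemma carrier_free_ring [simp]:
  "u \<in> carrier (free_ring X) \<longleftrightarrow> Poly_Mapping.keys u \<subseteq> lists X"
  by (simp add: free_ring_def)

lemma free_ring_simps [simp]:
  "\<one>\<^bsub>free_ring X\<^esub> = frag_of []"
  "\<zero>\<^bsub>free_ring X\<^esub> = 0"
  "u \<oplus>\<^bsub>free_ring X\<^esub> v = u + v"
  by (simp_all add: free_ring_def)

lemma free_ring_mult:
  "u \<otimes>\<^bsub>free_ring X\<^esub> v = frag_extend (\<lambda>xs. frag_extend (\<lambda>ys. frag_of (xs @ ys)) v) u"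
  by (simp add: free_ring_def)

lemma free_ring_mult_of [simp]:
  "frag_of xs \<otimes>\<^bsub>free_ring X\<^esub> frag_of ys = frag_of (xs @ ys)"
  by (simp add: free_ring_mult)

lemma frag_extend_add_fun: "frag_extend (\<lambda>x. f x + g x) u = frag_extend f u + frag_extend g u"
  by (simp add: frag_extend_def frag_cmul_distrib2 sum.distrib)

lemma free_ring_add_mult:
  "(u + u') \<otimes>\<^bsub>free_ring X\<^esub> v = u \<otimes>\<^bsub>free_ring X\<^esub> v + u' \<otimes>\<^bsub>free_ring X\<^esub> v"
  by (simp add: free_ring_mult frag_extend_add)

lemma free_ring_mult_add:
  "u \<otimes>\<^bsub>free_ring X\<^esub> (v + v') = u \<otimes>\<^bsub>free_ring X\<^esub> v + u \<otimes>\<^bsub>free_ring X\<^esub> v'"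
  by (simp add: free_ring_mult frag_extend_add frag_extend_add_fun)

lemma free_ring_diff_mult:
  "(u - u') \<otimes>\<^bsub>free_ring X\<^esub> v = u \<otimes>\<^bsub>free_ring X\<^esub> v - u' \<otimes>\<^bsub>free_ring X\<^esub> v"
  by (metis add_diff_cancel_right' diff_add_cancel free_ring_add_mult)

lemma free_ring_mult_diff:
  "u \<otimes>\<^bsub>free_ring X\<^esub> (v - v') = u \<otimes>\<^bsub>free_ring X\<^esub> v - u \<otimes>\<^bsub>free_ring X\<^esub> v'"
  by (metis add_diff_cancel_right' diff_add_cancel free_ring_mult_add)

lemma free_ring_zero_mult [simp]:
  "0 \<otimes>\<^bsub>free_ring X\<^esub> v = 0" "v \<otimes>\<^bsub>free_ring X\<^esub> 0 = 0"
  using free_ring_mult_diff[where u=v and v=0 and v'=0] by (simp_all add: free_ring_mult)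

text \<open>Closure under differences rather than sums covers negative coefficients without a case
  of their own.\<close>

lemma free_ring_induct [consumes 1, case_names zero of diff]:
  assumes "u \<in> carrier (free_ring X)"
    and "P 0" "\<And>xs. xs \<in> lists X \<Longrightarrow> P (frag_of xs)"
    and "\<And>u v. \<lbrakk>u \<in> carrier (free_ring X); v \<in> carrier (free_ring X); P u; P v\<rbrakk> \<Longrightarrow> P (u - v)"
  shows "P u"
  using assms by (intro free_Abelian_group_induct[of u "lists X" P]) auto

lemma keys_diff_subset:
  "\<lbrakk>Poly_Mapping.keys u \<subseteq> X; Poly_Mapping.keys v \<subseteq> X\<rbrakk> \<Longrightarrow> Poly_Mapping.keys (u - v) \<subseteq> X"
  using keys_diff[of u v] by auto

lemma keys_frag_extend_subset:
  assumes "\<And>x. x \<in> Poly_Mapping.keys u \<Longrightarrow> Poly_Mapping.keys (f x) \<subseteq> Y"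
  shows "Poly_Mapping.keys (frag_extend f u) \<subseteq> Y"
  using keys_frag_extend by (rule subset_trans) (use assms in \<open>rule UN_least\<close>)

lemma free_ring_mult_closed:
  assumes u: "u \<in> carrier (free_ring X)" and v: "v \<in> carrier (free_ring X)"
  shows "u \<otimes>\<^bsub>free_ring X\<^esub> v \<in> carrier (free_ring X)"
  unfolding free_ring_mult carrier_free_ring
proof (intro keys_frag_extend_subset)
  fix xs ys
  assume "xs \<in> Poly_Mapping.keys u" "ys \<in> Poly_Mapping.keys v"
  then have "xs \<in> lists X" "ys \<in> lists X"
    using u v by (simp_all add: subsetD)
  then show "Poly_Mapping.keys (frag_of (xs @ ys)) \<subseteq> lists X"
    by (simp add: keys_frag_of)
qed

text \<open>Both sides are additive in each argument, so three nested inductions reduce the claim to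
  words, where it is associativity of concatenation.\<close>

lemma free_ring_mult_assoc:
  assumes u: "u \<in> carrier (free_ring X)" and v: "v \<in> carrier (free_ring X)"
    and w: "w \<in> carrier (free_ring X)"
  shows "(u \<otimes>\<^bsub>free_ring X\<^esub> v) \<otimes>\<^bsub>free_ring X\<^esub> w = u \<otimes>\<^bsub>free_ring X\<^esub> (v \<otimes>\<^bsub>free_ring X\<^esub> w)"
  using u
proof (induction rule: free_ring_induct)
  case (of xs)
  show ?case
    using v
  proof (induction rule: free_ring_induct)
    case (of ys)
    show ?case
      using w by (induction rule: free_ring_induct) (simp_all add: free_ring_mult_diff)
  qed (simp_all add: free_ring_diff_mult free_ring_mult_diff)
qed (simp_all add: free_ring_diff_mult)

lemma ring_free_ring: "ring (free_ring X)"
proof (rule ringI)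
  have add_closed: "u + v \<in> carrier (free_ring X)"
    if "u \<in> carrier (free_ring X)" "v \<in> carrier (free_ring X)" for u v
    using that keys_add[of u v] by auto
  show "abelian_group (free_ring X)"
  proof (rule abelian_groupI)
    fix u assume "u \<in> carrier (free_ring X)"
    then show "\<exists>v\<in>carrier (free_ring X). v \<oplus>\<^bsub>free_ring X\<^esub> u = \<zero>\<^bsub>free_ring X\<^esub>"
      by (intro bexI[of _ "- u"]) (simp_all add: keys_minus)
  qed (simp_all add: add_closed[simplified] add.assoc add.commute)
  show "Group.monoid (free_ring X)"
  proof (rule monoidI)
    fix u :: "'a list \<Rightarrow>\<^sub>0 int"
    show "\<one>\<^bsub>free_ring X\<^esub> \<otimes>\<^bsub>free_ring X\<^esub> u = u"
      by (simp add: free_ring_mult frag_expansion[symmetric])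
    show "u \<otimes>\<^bsub>free_ring X\<^esub> \<one>\<^bsub>free_ring X\<^esub> = u"
      by (simp add: free_ring_mult frag_expansion[symmetric])
    show "\<one>\<^bsub>free_ring X\<^esub> \<in> carrier (free_ring X)"
      by (simp add: keys_frag_of)
  qed (fact free_ring_mult_closed free_ring_mult_assoc)+
qed (simp_all add: free_ring_add_mult free_ring_mult_add)

text \<open>The inverse in a ring record is a description relative to the carrier; this links it to
  the subtraction of the type, in which the relations of \<open>T\<close> are written.\<close>

lemma free_ring_minus:
  assumes "v \<in> carrier (free_ring X)"
  shows "u \<ominus>\<^bsub>free_ring X\<^esub> v = u - v"
proof -
  interpret ring "free_ring X" by (rule ring_free_ring)
  show ?thesis
    using assms minus_equality[of "- v" v] by (simp add: a_minus_def keys_minus)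
qed

text \<open>The additive extension is the universal property of the free abelian group on words.
  Multiplicativity is then additive in each argument and reduces to
  \<open>val_append\<close>.\<close>

lemma (in ring) free_ring_universal:
  assumes f: "f \<in> X \<rightarrow> carrier R"
  obtains \<phi> where "\<phi> \<in> ring_hom (free_ring X) R" "\<And>x. x \<in> X \<Longrightarrow> \<phi> (frag_of [x]) = f x"
proof -
  define val where "val xs = foldr (\<lambda>x y. f x \<otimes> y) xs \<one>" for xs
  have val_closed: "val xs \<in> carrier R" if "xs \<in> lists X" for xs
    using that f by (induction xs) (auto simp: val_def)
  have val_append: "val (xs @ ys) = val xs \<otimes> val ys"
    if "xs \<in> lists X" "ys \<in> lists X" for xs ys
    using that
  proof (induction xs)
    case Nil
    then show ?case using val_closed[of ys] by (simp add: val_def)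
  next
    case (Cons x xs)
    moreover have "val (x # zs) = f x \<otimes> val zs" for zs
      by (simp add: val_def)
    ultimately show ?case
      using f val_closed[of xs] val_closed[of ys] Cons.prems by (auto simp: m_assoc Pi_iff)
  qed
  interpret F: ring "free_ring X" by (rule ring_free_ring)
  obtain \<phi> where hom: "\<phi> \<in> hom (free_Abelian_group (lists X)) (add_monoid R)"
    and on_words: "\<And>xs. xs \<in> lists X \<Longrightarrow> \<phi> (frag_of xs) = val xs"
    by (rule comm_group.free_Abelian_group_universal[OF a_comm_group, of val "lists X"])
      (use val_closed in auto)
  have closed: "\<phi> u \<in> carrier R" if "u \<in> carrier (free_ring X)" for u
    using hom that by (auto simp: hom_def)
  have add: "\<phi> (u + v) = \<phi> u \<oplus> \<phi> v"
    if "u \<in> carrier (free_ring X)" "v \<in> carrier (free_ring X)" for u v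
    using hom that by (auto simp: hom_def)
  interpret \<phi>: abelian_group_hom "free_ring X" R \<phi>
    by (intro abelian_group_homI F.abelian_group_axioms abelian_group_axioms group_hom.intro
        F.a_group a_group group_hom_axioms.intro homI) (simp_all add: closed add)
  \<comment> \<open>The inductions below pass through differences, whereas the homomorphism property
    speaks of sums.\<close>
  have on_diff: "\<phi> (u - v) = \<phi> u \<ominus> \<phi> v"
    if "u \<in> carrier (free_ring X)" "v \<in> carrier (free_ring X)" for u v
  proof -
    have "\<ominus>\<^bsub>free_ring X\<^esub> v = - v"
      using that by (intro F.minus_equality) auto
    with that show ?thesis
      using add[of u "- v"] \<phi>.hom_a_inv[of v] by (simp add: minus_eq keys_minus)
  qed
  have on_zero: "\<phi> 0 = \<zero>"
    using \<phi>.hom_zero by simp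
  have mult: "\<phi> (u \<otimes>\<^bsub>free_ring X\<^esub> v) = \<phi> u \<otimes> \<phi> v"
    if u: "u \<in> carrier (free_ring X)" and v: "v \<in> carrier (free_ring X)" for u v
    using u
  proof (induction rule: free_ring_induct)
    case zero
    then show ?case using on_zero closed[OF v] by simp
  next
    case (of xs)
    show ?case
      using v
    proof (induction rule: free_ring_induct)
      case zero
      then show ?case using on_zero val_closed of on_words by simp
    next
      case (of ys)
      then show ?case
        using \<open>xs \<in> lists X\<close> on_words val_append by simp
    next
      case (diff v w)
      have "frag_of xs \<in> carrier (free_ring X)"
        using of by (simp add: keys_frag_of)
      with diff show ?case
        using F.m_closed[of "frag_of xs"] closed
        by (simp add: free_ring_mult_diff on_diff r_minus r_distr minus_eq del: carrier_free_ring)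
    qed
  next
    case (diff u w)
    then show ?case
      using F.m_closed[OF _ v] closed closed[OF v]
      by (simp add: free_ring_diff_mult on_diff l_minus l_distr minus_eq del: carrier_free_ring)
  qed
  show thesis
  proof
    show "\<phi> \<in> ring_hom (free_ring X) R"
      using closed add mult on_words[of "[]"] by (intro ring_hom_memI) (auto simp: val_def)
    show "\<phi> (frag_of [x]) = f x" if "x \<in> X" for x
      using that f on_words[of "[x]"] by (auto simp: val_def Pi_iff)
  qed
qed

section \<open>The ring \<open>T(M, p)\<close>\<close>

locale pointed_bimodule = bimodule A B M
  for A :: "('a, 'x) ring_scheme"
    and B :: "('b, 'y) ring_scheme"
    and M :: "('a, 'b, 'm, 'z) bimodule_scheme" +
  fixes p :: 'm
  assumes p_closed [simp]: "p \<in> carrier M"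
begin

abbreviation "F \<equiv> free_ring (carrier M)"
abbreviation "I \<equiv> T_ideal A B M p"
abbreviation "T \<equiv> T_ring A B M p"
abbreviation "\<rho> \<equiv> rho_M A B M p"

text \<open>\<open>Idl\<close> is the intersection of the ideals that contain the relations;
  relations inside the carrier guarantee that such an ideal exists, and so that the result is an
  ideal.\<close>

lemma T_relations_closed: "T_relations A B M p \<subseteq> carrier F"
  unfolding T_relations_def
  by (auto simp: keys_frag_of lsmult_closed rsmult_closed
      dest!: subsetD[OF keys_add] subsetD[OF keys_diff] split: if_splits)

sublocale F: ring F
  by (rule ring_free_ring)

sublocale I: ideal I F
  unfolding T_ideal_def by (rule F.genideal_ideal[OF T_relations_closed])

sublocale T: ring T
  unfolding T_ring_def by (rule I.quotient_is_ring)

lemma T_proj_hom: "(\<lambda>u. I +>\<^bsub>F\<^esub> u) \<in> ring_hom F T"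
  unfolding T_ring_def by (rule I.rcos_ring_hom)

lemma T_proj_eqI:
  assumes "u - v \<in> T_relations A B M p" "u \<in> carrier F" "v \<in> carrier F"
  shows "I +>\<^bsub>F\<^esub> u = I +>\<^bsub>F\<^esub> v"
  using assms F.genideal_self[OF T_relations_closed]
  by (intro F.quotient_eq_iff_same_a_r_cos[THEN iffD1, OF I.is_ideal])
    (auto simp: free_ring_minus T_ideal_def simp del: carrier_free_ring)

lemma word_closed: "m \<in> carrier M \<Longrightarrow> frag_of [m] \<in> carrier F"
  by (simp add: keys_frag_of)

lemma rho_closed [simp]: "m \<in> carrier M \<Longrightarrow> \<rho> m \<in> carrier T"
  unfolding rho_M_def by (rule ring_hom_closed[OF T_proj_hom word_closed])

lemma rho_mult:
  assumes "m \<in> carrier M" "m' \<in> carrier M"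
  shows "\<rho> m \<otimes>\<^bsub>T\<^esub> \<rho> m' = I +>\<^bsub>F\<^esub> (frag_of [m] \<otimes>\<^bsub>F\<^esub> frag_of [m'])"
  unfolding rho_M_def using assms ring_hom_mult[OF T_proj_hom] word_closed by presburger

lemma rho_add:
  assumes "m \<in> carrier M" "m' \<in> carrier M"
  shows "\<rho> (m \<oplus>\<^bsub>M\<^esub> m') = \<rho> m \<oplus>\<^bsub>T\<^esub> \<rho> m'"
proof -
  have "\<rho> m \<oplus>\<^bsub>T\<^esub> \<rho> m' = I +>\<^bsub>F\<^esub> (frag_of [m] \<oplus>\<^bsub>F\<^esub> frag_of [m'])"
    unfolding rho_M_def using assms ring_hom_add[OF T_proj_hom] word_closed by presburger
  also have "\<dots> = \<rho> (m \<oplus>\<^bsub>M\<^esub> m')"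
    unfolding rho_M_def
  proof (rule T_proj_eqI)
    show "frag_of [m] \<oplus>\<^bsub>F\<^esub> frag_of [m'] - frag_of [m \<oplus>\<^bsub>M\<^esub> m'] \<in> T_relations A B M p"
      unfolding T_relations_def using assms by auto
  qed (use assms F.a_closed word_closed in blast)+
  finally show ?thesis by simp
qed

lemma rho_smult_mult:
  assumes "a \<in> carrier A" "m \<in> carrier M"
  shows "\<rho> (a \<odot>\<^bsub>M\<^esub> p) \<otimes>\<^bsub>T\<^esub> \<rho> m = \<rho> (a \<odot>\<^bsub>M\<^esub> m)"
  unfolding rho_mult[OF lsmult_closed[OF assms(1) p_closed] assms(2)] unfolding rho_M_def
proof (rule T_proj_eqI)
  show "frag_of [a \<odot>\<^bsub>M\<^esub> p] \<otimes>\<^bsub>F\<^esub> frag_of [m] - frag_of [a \<odot>\<^bsub>M\<^esub> m] \<in> T_relations A B M p"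
    unfolding T_relations_def using assms by auto
qed (use assms lsmult_closed p_closed F.m_closed word_closed in blast)+

lemma rho_mult_rsmult:
  assumes "b \<in> carrier B" "m \<in> carrier M"
  shows "\<rho> m \<otimes>\<^bsub>T\<^esub> \<rho> (p \<triangleleft>\<^bsub>M\<^esub> b) = \<rho> (m \<triangleleft>\<^bsub>M\<^esub> b)"
  unfolding rho_mult[OF assms(2) rsmult_closed[OF p_closed assms(1)]] unfolding rho_M_def
proof (rule T_proj_eqI)
  show "frag_of [m] \<otimes>\<^bsub>F\<^esub> frag_of [p \<triangleleft>\<^bsub>M\<^esub> b] - frag_of [m \<triangleleft>\<^bsub>M\<^esub> b] \<in> T_relations A B M p"
    unfolding T_relations_def using assms by auto
qed (use assms rsmult_closed p_closed F.m_closed word_closed in blast)+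

lemma rho_p [simp]: "\<rho> p = \<one>\<^bsub>T\<^esub>"
proof -
  have "\<rho> p = I +>\<^bsub>F\<^esub> \<one>\<^bsub>F\<^esub>"
    unfolding rho_M_def
  proof (rule T_proj_eqI)
    show "frag_of [p] - \<one>\<^bsub>F\<^esub> \<in> T_relations A B M p"
      unfolding T_relations_def by auto
  qed (simp_all add: keys_frag_of)
  also have "\<dots> = \<one>\<^bsub>T\<^esub>"
    by (rule ring_hom_one[OF T_proj_hom])
  finally show ?thesis .
qed

lemma rho_zero [simp]: "\<rho> \<zero>\<^bsub>M\<^esub> = \<zero>\<^bsub>T\<^esub>"
  using rho_add[of "\<zero>\<^bsub>M\<^esub>" "\<zero>\<^bsub>M\<^esub>"] T.add.l_cancel_one[of "\<rho> \<zero>\<^bsub>M\<^esub>" "\<rho> \<zero>\<^bsub>M\<^esub>"] by simp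

section \<open>Generators and universal property of T(M, p)\<close>

lemma carrier_T: "carrier T = (\<lambda>u. I +>\<^bsub>F\<^esub> u) ` carrier F"
  by (auto simp: T_ring_def FactRing_def A_RCOSETS_def' )

text \<open>\<open>T\<close> is generated as a ring by the elements \<open>\<rho> m\<close>. This
  yields the uniqueness of morphisms out of \<open>T\<close>, in a form that also applies to maps
  that preserve products and differences without being packaged as ring morphisms.\<close>

lemma T_induct [consumes 1, case_names one rho mult diff]:
  assumes t: "t \<in> carrier T" and one: "P \<one>\<^bsub>T\<^esub>"
    and rho: "\<And>m. m \<in> carrier M \<Longrightarrow> P (\<rho> m)"
    and mult: "\<And>s t. \<lbrakk>s \<in> carrier T; t \<in> carrier T; P s; P t\<rbrakk> \<Longrightarrow> P (s \<otimes>\<^bsub>T\<^esub> t)"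
    and diff: "\<And>s t. \<lbrakk>s \<in> carrier T; t \<in> carrier T; P s; P t\<rbrakk> \<Longrightarrow> P (s \<ominus>\<^bsub>T\<^esub> t)"
  shows "P t"
proof -
  interpret proj: ring_hom_ring F T "\<lambda>u. I +>\<^bsub>F\<^esub> u"
    by (intro ring_hom_ringI2 F.ring_axioms T.ring_axioms T_proj_hom)
  have "P (I +>\<^bsub>F\<^esub> u)" if "u \<in> carrier F" for u
    using that
  proof (induction rule: free_ring_induct)
    case zero
    \<comment> \<open>Zero is reached as 1 - 1.\<close>
    have "P (\<one>\<^bsub>T\<^esub> \<ominus>\<^bsub>T\<^esub> \<one>\<^bsub>T\<^esub>)"
      by (intro diff one T.one_closed)
    then show ?case
      using proj.hom_zero by (simp add: T.minus_eq T.r_neg)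
  next
    case (of xs)
    then show ?case
    proof (induction xs)
      case Nil
      then show ?case
        using proj.hom_one one by simp
    next
      case (Cons x xs)
      have closed: "x \<in> carrier M" "frag_of xs \<in> carrier F" "xs \<in> lists (carrier M)"
        using Cons by (simp_all add: keys_frag_of)
      have "P (\<rho> x \<otimes>\<^bsub>T\<^esub> (I +>\<^bsub>F\<^esub> frag_of xs))"
        by (intro mult rho rho_closed proj.hom_closed closed Cons.IH)
      also have "\<rho> x \<otimes>\<^bsub>T\<^esub> (I +>\<^bsub>F\<^esub> frag_of xs) = I +>\<^bsub>F\<^esub> (frag_of [x] \<otimes>\<^bsub>F\<^esub> frag_of xs)"
        unfolding rho_M_def using closed proj.hom_mult word_closed by presburger
      finally show ?case
        by simp
    qed
  next
    case (diff u v)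
    have "I +>\<^bsub>F\<^esub> (u - v) = (I +>\<^bsub>F\<^esub> u) \<ominus>\<^bsub>T\<^esub> (I +>\<^bsub>F\<^esub> v)"
      using diff free_ring_minus[of v _ u] proj.hom_add[of u "\<ominus>\<^bsub>F\<^esub> v"]
      by (simp add: a_minus_def del: free_ring_simps carrier_free_ring)
    with diff show ?case
      using assms(5) proj.hom_closed by metis
  qed
  with t show ?thesis
    unfolding carrier_T by auto
qed

text \<open>The existence half of initiality, with the maps from \<open>A\<close> and
  \<open>B\<close> encoded as \<open>f (a \<odot> p)\<close> and
  \<open>f (p \<triangleleft> b)\<close>. The extension of \<open>f\<close> to the free ring kills
  the relations, hence the ideal that they generate, and descends to the quotient.\<close>

lemma T_universal:
  assumes S: "ring S" and f: "f \<in> carrier M \<rightarrow> carrier S"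
    and add: "\<And>m m'. \<lbrakk>m \<in> carrier M; m' \<in> carrier M\<rbrakk> \<Longrightarrow> f (m \<oplus>\<^bsub>M\<^esub> m') = f m \<oplus>\<^bsub>S\<^esub> f m'"
    and left: "\<And>a m. \<lbrakk>a \<in> carrier A; m \<in> carrier M\<rbrakk> \<Longrightarrow> f (a \<odot>\<^bsub>M\<^esub> p) \<otimes>\<^bsub>S\<^esub> f m = f (a \<odot>\<^bsub>M\<^esub> m)"
    and right: "\<And>m b. \<lbrakk>m \<in> carrier M; b \<in> carrier B\<rbrakk> \<Longrightarrow> f m \<otimes>\<^bsub>S\<^esub> f (p \<triangleleft>\<^bsub>M\<^esub> b) = f (m \<triangleleft>\<^bsub>M\<^esub> b)"
    and p: "f p = \<one>\<^bsub>S\<^esub>"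
  obtains \<theta> where "\<theta> \<in> ring_hom T S" "\<And>m. m \<in> carrier M \<Longrightarrow> \<theta> (\<rho> m) = f m"
proof -
  interpret S: ring S by fact
  obtain \<phi> where \<phi>: "\<phi> \<in> ring_hom F S" and \<phi>_of: "\<And>m. m \<in> carrier M \<Longrightarrow> \<phi> (frag_of [m]) = f m"
    using S.free_ring_universal[OF f] by blast
  interpret \<phi>: ring_hom_ring F S \<phi>
    by (intro ring_hom_ringI2 F.ring_axioms S.ring_axioms \<phi>)
  \<comment> \<open>Every relation is a difference of two elements, so it lies in the kernel as soon
    as \<open>\<phi>\<close> takes the same value on both.\<close>
  have diff_mem: "u - v \<in> a_kernel F S \<phi>"
    if "u \<in> carrier F" "v \<in> carrier F" "\<phi> u = \<phi> v" for u v
  proof -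
    have "\<phi> (u \<ominus>\<^bsub>F\<^esub> v) = \<zero>\<^bsub>S\<^esub>"
      unfolding hom_minus[OF \<phi>.ring_hom_ring_axioms that(1,2)] that(3)
      by (simp only: a_minus_def S.r_neg \<phi>.hom_closed[OF that(2)])
    moreover have "u \<ominus>\<^bsub>F\<^esub> v \<in> carrier F"
      using that by (intro F.minus_closed)
    ultimately show ?thesis
      unfolding free_ring_minus[OF that(2), symmetric] a_kernel_def' by blast
  qed
  have "T_relations A B M p \<subseteq> a_kernel F S \<phi>"
  proof
    fix r assume "r \<in> T_relations A B M p"
    then show "r \<in> a_kernel F S \<phi>"
      unfolding T_relations_def
    proof (elim UnE CollectE exE conjE singletonE)
      fix m m'
      assume r: "r = frag_of [m] + frag_of [m'] - frag_of [m \<oplus>\<^bsub>M\<^esub> m']"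
        and m: "m \<in> carrier M" "m' \<in> carrier M"
      \<comment> \<open>The sum is restated with the addition of the record, the form in which the
        homomorphism rules for \<open>\<phi>\<close> apply.\<close>
      have "frag_of [m] \<oplus>\<^bsub>F\<^esub> frag_of [m'] - frag_of [m \<oplus>\<^bsub>M\<^esub> m'] \<in> a_kernel F S \<phi>"
        using m assms(3) word_closed \<phi>_of
        by (intro diff_mem) (simp_all del: free_ring_simps carrier_free_ring)
      then show ?thesis
        by (simp add: r)
    next
      fix a m
      assume r: "r = frag_of [a \<odot>\<^bsub>M\<^esub> p] \<otimes>\<^bsub>F\<^esub> frag_of [m] - frag_of [a \<odot>\<^bsub>M\<^esub> m]"
        and m: "a \<in> carrier A" "m \<in> carrier M"
      show ?thesis
        unfolding r using m assms(4) word_closed \<phi>_of lsmult_closed[of a]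
        by (intro diff_mem) (simp_all del: free_ring_simps carrier_free_ring free_ring_mult_of)
    next
      fix m b
      assume r: "r = frag_of [m] \<otimes>\<^bsub>F\<^esub> frag_of [p \<triangleleft>\<^bsub>M\<^esub> b] - frag_of [m \<triangleleft>\<^bsub>M\<^esub> b]"
        and m: "m \<in> carrier M" "b \<in> carrier B"
      show ?thesis
        unfolding r using m assms(5) word_closed \<phi>_of rsmult_closed[of _ b]
        by (intro diff_mem) (simp_all del: free_ring_simps carrier_free_ring free_ring_mult_of)
    next
      assume r: "r = frag_of [p] - \<one>\<^bsub>F\<^esub>"
      show ?thesis
        unfolding r using assms(6) word_closed \<phi>_of
        by (intro diff_mem) (simp_all del: free_ring_simps carrier_free_ring)
    qed
  qed
  then have ker: "I \<subseteq> a_kernel F S \<phi>"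
    unfolding T_ideal_def by (rule F.genideal_minimal[OF \<phi>.kernel_is_ideal])
  have well_defined: "\<phi> u = \<phi> v"
    if "u \<in> carrier F" "v \<in> carrier F" "I +>\<^bsub>F\<^esub> u = I +>\<^bsub>F\<^esub> v" for u v
  proof -
    have "u \<ominus>\<^bsub>F\<^esub> v \<in> a_kernel F S \<phi>"
      by (intro subsetD[OF ker] iffD2[OF F.quotient_eq_iff_same_a_r_cos[OF I.is_ideal that(1,2)]] that)
    then have "\<phi> (u \<ominus>\<^bsub>F\<^esub> v) = \<zero>\<^bsub>S\<^esub>"
      unfolding a_kernel_def' by (rule CollectE) (erule conjunct2)
    then have "\<phi> u \<ominus>\<^bsub>S\<^esub> \<phi> v = \<zero>\<^bsub>S\<^esub>"
      by (simp only: hom_minus[OF \<phi>.ring_hom_ring_axioms that(1,2)])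
    then show ?thesis
      by (rule S.minus_zero_imp_eq[OF _ \<phi>.hom_closed[OF that(1)] \<phi>.hom_closed[OF that(2)]])
  qed
  \<comment> \<open>A coset is evaluated at a chosen representative; \<open>well_defined\<close>
    makes the value independent of the choice.\<close>
  define \<theta> where "\<theta> = \<phi> \<circ> inv_into (carrier F) (\<lambda>u. I +>\<^bsub>F\<^esub> u)"
  have \<theta>: "\<phi> u = \<theta> (I +>\<^bsub>F\<^esub> u)" if "u \<in> carrier F" for u
    unfolding \<theta>_def comp_def
    using that by (intro well_defined inv_into_into f_inv_into_f[symmetric] imageI)
  show thesis
  proof
    show "\<theta> \<in> ring_hom T S"
    proof (rule ring_hom_memI)
      fix s assume "s \<in> carrier T"
      then obtain u where u: "u \<in> carrier F" "s = I +>\<^bsub>F\<^esub> u"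
        unfolding carrier_T by blast
      then show "\<theta> s \<in> carrier S"
        using \<theta> \<phi>.hom_closed by metis
      fix t assume "t \<in> carrier T"
      then obtain v where v: "v \<in> carrier F" "t = I +>\<^bsub>F\<^esub> v"
        unfolding carrier_T by blast
      have "s \<otimes>\<^bsub>T\<^esub> t = I +>\<^bsub>F\<^esub> (u \<otimes>\<^bsub>F\<^esub> v)"
        using u v ring_hom_mult[OF T_proj_hom] by presburger
      with u v show "\<theta> (s \<otimes>\<^bsub>T\<^esub> t) = \<theta> s \<otimes>\<^bsub>S\<^esub> \<theta> t"
        using \<theta> F.m_closed \<phi>.hom_mult by metis
      have "s \<oplus>\<^bsub>T\<^esub> t = I +>\<^bsub>F\<^esub> (u \<oplus>\<^bsub>F\<^esub> v)"
        using u v ring_hom_add[OF T_proj_hom] by presburger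
      with u v show "\<theta> (s \<oplus>\<^bsub>T\<^esub> t) = \<theta> s \<oplus>\<^bsub>S\<^esub> \<theta> t"
        using \<theta> F.a_closed \<phi>.hom_add by metis
    next
      show "\<theta> \<one>\<^bsub>T\<^esub> = \<one>\<^bsub>S\<^esub>"
        using \<theta>[OF F.one_closed] ring_hom_one[OF T_proj_hom] \<phi>.hom_one by metis
    qed
    show "\<theta> (\<rho> m) = f m" if "m \<in> carrier M" for m
      using \<theta>[OF word_closed] \<phi>_of that unfolding rho_M_def by metis
  qed
qed

end

section \<open>Extension of scalars\<close>

lemma free_coset_eqI:
  assumes "subgroup N (free_Abelian_group X)" "u - v \<in> N"
    and "Poly_Mapping.keys u \<subseteq> X" "Poly_Mapping.keys v \<subseteq> X"
  shows "N #>\<^bsub>free_Abelian_group X\<^esub> u = N #>\<^bsub>free_Abelian_group X\<^esub> v"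
proof -
  interpret group "free_Abelian_group X" by (rule group_free_Abelian_group)
  have "u \<in> N #>\<^bsub>free_Abelian_group X\<^esub> v"
    unfolding r_coset_def using assms(2) by (force intro!: bexI[of _ "u - v"])
  then show ?thesis
    using assms(1,4) repr_independence by (metis carrier_free_Abelian_group_iff)
qed

lemma group_hom_frag_extend:
  assumes "\<And>x. x \<in> X \<Longrightarrow> f x \<in> Y"
  shows "group_hom (free_Abelian_group X) (free_Abelian_group Y) (frag_extend (\<lambda>x. frag_of (f x)))"
  by (intro group_hom.intro group_hom_axioms.intro group_free_Abelian_group homI)
    (use assms in \<open>auto simp: frag_extend_add keys_frag_of intro!: keys_frag_extend_subset\<close>)

text \<open>A homomorphism that sends the generators \<open>K\<close> into \<open>N'\<close> sends
  all of \<open>N\<close> there. The cosets united in \<open>tensor_induced\<close> are then all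
  equal, and the one at \<open>u\<close> is among them, so the union can be computed at any
  representative.\<close>

lemma tensor_induced_coset:
  assumes f: "\<And>x. x \<in> X \<Longrightarrow> f x \<in> Y"
    and K: "K \<subseteq> carrier (free_Abelian_group X)"
    and N: "N = generate (free_Abelian_group X) K"
    and N': "subgroup N' (free_Abelian_group Y)"
    and ext: "\<And>k. k \<in> K \<Longrightarrow> frag_extend (\<lambda>x. frag_of (f x)) k \<in> N'"
    and u: "u \<in> carrier (free_Abelian_group X)"
  shows "tensor_induced (free_Abelian_group Y) N' f (N #>\<^bsub>free_Abelian_group X\<^esub> u)
    = N' #>\<^bsub>free_Abelian_group Y\<^esub> frag_extend (\<lambda>x. frag_of (f x)) u"
proof -
  let ?h = "frag_extend (\<lambda>x. frag_of (f x))"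
  interpret h: group_hom "free_Abelian_group X" "free_Abelian_group Y" ?h
    using f by (rule group_hom_frag_extend)
  interpret N: subgroup N "free_Abelian_group X"
    unfolding N using K by (rule h.G.generate_is_subgroup)
  have "?h ` N \<subseteq> N'"
    unfolding N h.generate_img[OF K, symmetric]
    by (rule h.H.generate_subgroup_incl[OF _ N']) (use ext in \<open>rule image_subsetI\<close>)
  then have hN: "?h n \<in> N'" if "n \<in> N" for n
    using that by (rule image_subset_iff[THEN iffD1, rule_format])
  have same: "N' #>\<^bsub>free_Abelian_group Y\<^esub> ?h c = N' #>\<^bsub>free_Abelian_group Y\<^esub> ?h u"
    if c: "c \<in> N #>\<^bsub>free_Abelian_group X\<^esub> u" for c
  proof -
    obtain n where n: "n \<in> N" "c = n + u"
      using c by (auto simp: r_coset_def)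
    have "c \<in> carrier (free_Abelian_group X)"
      using h.G.m_closed[OF N.mem_carrier[OF n(1)] u] n(2) by simp
    then have "?h c \<in> carrier (free_Abelian_group Y)" "?h u \<in> carrier (free_Abelian_group Y)"
      using u h.hom_closed by blast+
    then show ?thesis
      using hN[OF n(1)] by (intro free_coset_eqI[OF N']) (simp_all add: n(2) frag_extend_add)
  qed
  have "u \<in> N #>\<^bsub>free_Abelian_group X\<^esub> u"
    using h.G.rcos_self[OF u N.subgroup_axioms] .
  then show ?thesis
    unfolding tensor_induced_def using same by blast
qed

section \<open>The tensor product by generators and relations\<close>

locale scalar_extension =
  fixes R :: "('r, 'x) ring_scheme"
    and S :: "('s, 'w) ring_scheme"
    and g :: "'r \<Rightarrow> 's"
    and P :: "('r, 'p, 'z) module_scheme"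
  assumes ring_S: "ring S"
    and g_closed: "r \<in> carrier R \<Longrightarrow> g r \<in> carrier S"
    and add_closed: "\<lbrakk>x \<in> carrier P; y \<in> carrier P\<rbrakk> \<Longrightarrow> x \<oplus>\<^bsub>P\<^esub> y \<in> carrier P"
    and smult_closed: "\<lbrakk>r \<in> carrier R; x \<in> carrier P\<rbrakk> \<Longrightarrow> r \<odot>\<^bsub>P\<^esub> x \<in> carrier P"
begin

sublocale S: ring S by (rule ring_S)

abbreviation "Fr \<equiv> free_Abelian_group (carrier S \<times> carrier P)"
abbreviation "N \<equiv> tensor_relations R S g P"
abbreviation "Tens \<equiv> tensor_module R S g P"

text \<open>The generators of \<open>tensor_relations\<close> get a name so that maps out of the
  tensor product can be tested on them by \<open>rels_cases\<close>.\<close>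

definition rels :: "('s \<times> 'p \<Rightarrow>\<^sub>0 int) set" where
  "rels = {frag_of (s \<oplus>\<^bsub>S\<^esub> s', x) - frag_of (s, x) - frag_of (s', x) | s s' x.
        s \<in> carrier S \<and> s' \<in> carrier S \<and> x \<in> carrier P} \<union>
     {frag_of (s, x \<oplus>\<^bsub>P\<^esub> x') - frag_of (s, x) - frag_of (s, x') | s x x'.
        s \<in> carrier S \<and> x \<in> carrier P \<and> x' \<in> carrier P} \<union>
     {frag_of (s \<otimes>\<^bsub>S\<^esub> g r, x) - frag_of (s, r \<odot>\<^bsub>P\<^esub> x) | s r x.
        s \<in> carrier S \<and> r \<in> carrier R \<and> x \<in> carrier P}"

lemma tensor_relations_eq: "N = generate Fr rels"
  unfolding tensor_relations_def rels_def tensor_free_def ..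

lemma rels_cases [consumes 1, case_names add_left add_right balanced]:
  assumes "k \<in> rels"
  obtains s s' x where "s \<in> carrier S" "s' \<in> carrier S" "x \<in> carrier P"
      "k = frag_of (s \<oplus>\<^bsub>S\<^esub> s', x) - frag_of (s, x) - frag_of (s', x)"
    | s x x' where "s \<in> carrier S" "x \<in> carrier P" "x' \<in> carrier P"
      "k = frag_of (s, x \<oplus>\<^bsub>P\<^esub> x') - frag_of (s, x) - frag_of (s, x')"
    | s r x where "s \<in> carrier S" "r \<in> carrier R" "x \<in> carrier P"
      "k = frag_of (s \<otimes>\<^bsub>S\<^esub> g r, x) - frag_of (s, r \<odot>\<^bsub>P\<^esub> x)"
  using assms unfolding rels_def
  by (elim UnE CollectE exE conjE) (rule that; assumption)+

lemma rels_subset: "rels \<subseteq> carrier Fr"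
proof
  fix k assume "k \<in> rels"
  then show "k \<in> carrier Fr"
    by (cases rule: rels_cases)
      (simp_all add: keys_diff_subset keys_frag_of g_closed add_closed smult_closed)
qed

sublocale Fr: comm_group Fr
  by (rule abelian_free_Abelian_group)

sublocale N: subgroup N Fr
  unfolding tensor_relations_eq using rels_subset by (rule Fr.generate_is_subgroup)

lemma normal_N: "N \<lhd> Fr"
  using N.subgroup_axioms Fr.normal_iff_subgroup by blast

lemma N_diff: "\<lbrakk>u \<in> N; v \<in> N\<rbrakk> \<Longrightarrow> u - v \<in> N"
  using N.m_closed[OF _ N.m_inv_closed, of u v] N.mem_carrier[of v] by simp

lemma N_uminus: "u \<in> N \<Longrightarrow> - u \<in> N"
  using N_diff[OF N.one_closed] by simp

lemma N_add: "\<lbrakk>u \<in> N; v \<in> N\<rbrakk> \<Longrightarrow> u + v \<in> N"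
  using N.m_closed by simp

lemma add_left_mem:
  "\<lbrakk>s \<in> carrier S; s' \<in> carrier S; x \<in> carrier P\<rbrakk> \<Longrightarrow>
    frag_of (s \<oplus>\<^bsub>S\<^esub> s', x) - frag_of (s, x) - frag_of (s', x) \<in> N"
  unfolding tensor_relations_eq rels_def by (intro generate.incl) blast

lemma add_right_mem:
  "\<lbrakk>s \<in> carrier S; x \<in> carrier P; x' \<in> carrier P\<rbrakk> \<Longrightarrow>
    frag_of (s, x \<oplus>\<^bsub>P\<^esub> x') - frag_of (s, x) - frag_of (s, x') \<in> N"
  unfolding tensor_relations_eq rels_def by (intro generate.incl) blast

lemma balanced_mem:
  "\<lbrakk>s \<in> carrier S; r \<in> carrier R; x \<in> carrier P\<rbrakk> \<Longrightarrow>
    frag_of (s \<otimes>\<^bsub>S\<^esub> g r, x) - frag_of (s, r \<odot>\<^bsub>P\<^esub> x) \<in> N"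
  unfolding tensor_relations_eq rels_def by (intro generate.incl) blast

text \<open>Pure tensors. For a module generated by one vector they exhaust the tensor product, see
  \<open>tensor_pure\<close>.\<close>

definition tens :: "'s \<Rightarrow> 'p \<Rightarrow> ('s \<times> 'p \<Rightarrow>\<^sub>0 int) set" where
  "tens s x = N #>\<^bsub>Fr\<^esub> frag_of (s, x)"

lemma carrier_tensor: "carrier Tens = (\<lambda>u. N #>\<^bsub>Fr\<^esub> u) ` carrier Fr"
  by (simp add: tensor_module_def Let_def carrier_FactGroup tensor_free_def)

lemma tensor_add: "C \<oplus>\<^bsub>Tens\<^esub> D = C <#>\<^bsub>Fr\<^esub> D"
  by (simp add: tensor_module_def Let_def tensor_free_def)

lemma tens_closed: "\<lbrakk>s \<in> carrier S; x \<in> carrier P\<rbrakk> \<Longrightarrow> tens s x \<in> carrier Tens"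
  unfolding tens_def carrier_tensor by (intro imageI) simp

lemma tens_add:
  assumes "s \<in> carrier S" "s' \<in> carrier S" "x \<in> carrier P"
  shows "tens s x \<oplus>\<^bsub>Tens\<^esub> tens s' x = tens (s \<oplus>\<^bsub>S\<^esub> s') x"
proof -
  have "tens s x \<oplus>\<^bsub>Tens\<^esub> tens s' x = N #>\<^bsub>Fr\<^esub> (frag_of (s, x) + frag_of (s', x))"
    unfolding tens_def tensor_add using assms by (subst normal.rcos_sum[OF normal_N]) simp_all
  also have "\<dots> = tens (s \<oplus>\<^bsub>S\<^esub> s') x"
    unfolding tens_def
  proof (rule free_coset_eqI[OF N.subgroup_axioms])
    show "frag_of (s, x) + frag_of (s', x) - frag_of (s \<oplus>\<^bsub>S\<^esub> s', x) \<in> N"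
      using N_uminus[OF add_left_mem[OF assms]] by (simp add: algebra_simps)
    show "Poly_Mapping.keys (frag_of (s, x) + frag_of (s', x)) \<subseteq> carrier S \<times> carrier P"
      using assms by (intro subset_trans[OF keys_add]) (simp add: keys_frag_of)
  qed (use assms in \<open>simp add: keys_frag_of\<close>)
  finally show ?thesis .
qed

lemma tens_balanced:
  assumes "s \<in> carrier S" "r \<in> carrier R" "x \<in> carrier P"
  shows "tens (s \<otimes>\<^bsub>S\<^esub> g r) x = tens s (r \<odot>\<^bsub>P\<^esub> x)"
  unfolding tens_def using assms
  by (intro free_coset_eqI[OF N.subgroup_axioms balanced_mem])
    (simp_all add: keys_frag_of g_closed smult_closed)

text \<open>Left multiplication by \<open>s\<close> is compatible with the balancing relation
  because \<open>R\<close> acts on \<open>S\<close> from the other side: this is associativity of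
  \<open>S\<close>.\<close>

lemma tensor_smult:
  assumes "s \<in> carrier S" "t \<in> carrier S" "x \<in> carrier P"
  shows "s \<odot>\<^bsub>Tens\<^esub> tens t x = tens (s \<otimes>\<^bsub>S\<^esub> t) x"
proof -
  let ?f = "\<lambda>(t, x). (s \<otimes>\<^bsub>S\<^esub> t, x)"
  have "s \<odot>\<^bsub>Tens\<^esub> tens t x = tensor_induced Fr N ?f (tens t x)"
    by (simp add: tensor_module_def Let_def tensor_free_def)
  also have "\<dots> = N #>\<^bsub>Fr\<^esub> frag_extend (\<lambda>x. frag_of (?f x)) (frag_of (t, x))"
    unfolding tens_def
  proof (rule tensor_induced_coset[OF _ rels_subset tensor_relations_eq N.subgroup_axioms])
    fix k assume "k \<in> rels"
    then show "frag_extend (\<lambda>x. frag_of (?f x)) k \<in> N"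
    proof (cases rule: rels_cases)
      case (add_left t t' x)
      then show ?thesis
        using add_left_mem[of "s \<otimes>\<^bsub>S\<^esub> t" "s \<otimes>\<^bsub>S\<^esub> t'" x] assms(1)
        by (simp add: frag_extend_diff S.r_distr)
    next
      case (add_right t x x')
      then show ?thesis
        using add_right_mem[of "s \<otimes>\<^bsub>S\<^esub> t" x x'] assms(1)
        by (simp add: frag_extend_diff)
    next
      case (balanced t r x)
      then show ?thesis
        using balanced_mem[of "s \<otimes>\<^bsub>S\<^esub> t" r x] assms(1)
        by (simp add: frag_extend_diff S.m_assoc g_closed)
    qed
  qed (use assms in \<open>auto simp: keys_frag_of\<close>)
  finally show ?thesis
    by (simp add: tens_def)
qed

text \<open>Additivity of \<sigma> preserves the additivity relations in the second argument, and
  its linearity preserves the balancing relations.\<close>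

lemma tensor_map_tens:
  assumes Q: "scalar_extension R S g Q" and \<sigma>: "\<sigma> \<in> left_module_hom R P Q"
    and s: "s \<in> carrier S" and x: "x \<in> carrier P"
  shows "tensor_map R S g Q \<sigma> (tens s x) = scalar_extension.tens R S g Q s (\<sigma> x)"
proof -
  interpret Q: scalar_extension R S g Q by fact
  let ?f = "\<lambda>(s, x). (s, \<sigma> x)"
  have \<sigma>_closed: "\<sigma> x \<in> carrier Q" if "x \<in> carrier P" for x
    using \<sigma> that by (auto simp: left_module_hom_def)
  have "tensor_map R S g Q \<sigma> (tens s x) = tensor_induced Q.Fr Q.N ?f (tens s x)"
    by (simp add: tensor_map_def tensor_free_def)
  also have "\<dots> = Q.N #>\<^bsub>Q.Fr\<^esub> frag_extend (\<lambda>x. frag_of (?f x)) (frag_of (s, x))"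
    unfolding tens_def
  proof (rule tensor_induced_coset[OF _ rels_subset tensor_relations_eq Q.N.subgroup_axioms])
    fix k assume "k \<in> rels"
    then show "frag_extend (\<lambda>x. frag_of (?f x)) k \<in> Q.N"
    proof (cases rule: rels_cases)
      case (add_left t t' x)
      then show ?thesis
        using Q.add_left_mem[of t t' "\<sigma> x"] \<sigma>_closed by (simp add: frag_extend_diff)
    next
      case (add_right t x x')
      then show ?thesis
        using Q.add_right_mem[of t "\<sigma> x" "\<sigma> x'"] \<sigma> \<sigma>_closed
        by (simp add: frag_extend_diff left_module_hom_def)
    next
      case (balanced t r x)
      then show ?thesis
        using Q.balanced_mem[of t r "\<sigma> x"] \<sigma> \<sigma>_closed
        by (simp add: frag_extend_diff left_module_hom_def)
    qed
  qed (use s x \<sigma>_closed in \<open>auto simp: keys_frag_of\<close>)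
  finally show ?thesis
    by (simp add: Q.tens_def)
qed

end

section \<open>Extension of scalars for a column of the ring\<close>

text \<open>
  The embedding \<open>c\<close> of \<open>P\<close> into \<open>R\<close> is split by the map sending \<open>r\<close> to \<open>r x\<^sub>0\<close>, so that
  \<open>S \<otimes> P\<close> is identified with the left ideal of \<open>S\<close> generated by the idempotent \<open>g (c x\<^sub>0)\<close>.
\<close>

locale cyclic_scalar_extension = scalar_extension +
  fixes c and x\<^sub>0
  assumes c_closed: "x \<in> carrier P \<Longrightarrow> c x \<in> carrier R"
    and c_add: "\<lbrakk>x \<in> carrier P; y \<in> carrier P\<rbrakk> \<Longrightarrow> g (c (x \<oplus>\<^bsub>P\<^esub> y)) = g (c x) \<oplus>\<^bsub>S\<^esub> g (c y)"
    and c_smult: "\<lbrakk>r \<in> carrier R; x \<in> carrier P\<rbrakk> \<Longrightarrow> g (c (r \<odot>\<^bsub>P\<^esub> x)) = g r \<otimes>\<^bsub>S\<^esub> g (c x)"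
    and x0_closed: "x\<^sub>0 \<in> carrier P"
    and c_x0: "x \<in> carrier P \<Longrightarrow> c x \<odot>\<^bsub>P\<^esub> x\<^sub>0 = x"
begin

text \<open>Write \<open>x\<close> as \<open>c x\<close> acting on \<open>x\<^sub>0\<close> and move
  \<open>c x\<close> across the tensor sign.\<close>

lemma tens_eq_x0:
  assumes "s \<in> carrier S" "x \<in> carrier P"
  shows "tens s x = tens (s \<otimes>\<^bsub>S\<^esub> g (c x)) x\<^sub>0"
  using tens_balanced[OF assms(1) c_closed[OF assms(2)] x0_closed] by (simp only: c_x0[OF assms(2)])

text \<open>All pure tensors can be brought to the second entry \<open>x\<^sub>0\<close>, and
  differences of such tensors are again of this form by additivity in the first entry. The induction
  runs over representatives modulo \<open>N\<close>.\<close>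

lemma tensor_pure:
  assumes "t \<in> carrier Tens"
  obtains s where "s \<in> carrier S" "t = tens s x\<^sub>0"
proof -
  have pure: "\<exists>s\<in>carrier S. u - frag_of (s, x\<^sub>0) \<in> N" if "u \<in> carrier Fr" for u
    using that unfolding carrier_free_Abelian_group_iff
  proof (induction u rule: free_Abelian_group_induct[consumes 1, case_names zero diff of])
    case zero
    \<comment> \<open>The additivity relation for 0 + 0 = 0 is minus the generator at 0.\<close>
    have "0 - frag_of (\<zero>\<^bsub>S\<^esub>, x\<^sub>0) \<in> N"
      using add_left_mem[of "\<zero>\<^bsub>S\<^esub>" "\<zero>\<^bsub>S\<^esub>" x\<^sub>0] x0_closed by simp
    then show ?case by (rule bexI[OF _ S.zero_closed])
  next
    case (diff u v)
    from diff.IH obtain s s' where s: "s \<in> carrier S" "s' \<in> carrier S"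
      and mem: "u - frag_of (s, x\<^sub>0) \<in> N" "v - frag_of (s', x\<^sub>0) \<in> N"
      by blast
    \<comment> \<open>The additivity relation for \<open>s = (s - s') + s'\<close>.\<close>
    have "frag_of (s, x\<^sub>0) - frag_of (s \<ominus>\<^bsub>S\<^esub> s', x\<^sub>0) - frag_of (s', x\<^sub>0) \<in> N"
      using add_left_mem[of "s \<ominus>\<^bsub>S\<^esub> s'" s' x\<^sub>0] x0_closed s
      by (simp add: S.minus_eq S.a_assoc S.l_neg)
    from N_add[OF N_diff[OF mem] this]
    have "u - v - frag_of (s \<ominus>\<^bsub>S\<^esub> s', x\<^sub>0) \<in> N"
      by (simp add: algebra_simps)
    then show ?case
      by (rule bexI[OF _ S.minus_closed[OF s]])
  next
    case (of sx)
    then obtain s x where sx: "sx = (s, x)" "s \<in> carrier S" "x \<in> carrier P" by blast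
    have "frag_of sx - frag_of (s \<otimes>\<^bsub>S\<^esub> g (c x), x\<^sub>0) \<in> N"
      using N_uminus[OF balanced_mem[OF sx(2) c_closed[OF sx(3)] x0_closed]] sx(1)
      by (simp add: c_x0[OF sx(3)])
    then show ?case
      using S.m_closed[OF sx(2) g_closed[OF c_closed[OF sx(3)]]] by (rule bexI)
  qed
  obtain u where u: "u \<in> carrier Fr" "t = N #>\<^bsub>Fr\<^esub> u"
    using assms unfolding carrier_tensor by blast
  with pure obtain s where s: "s \<in> carrier S" "u - frag_of (s, x\<^sub>0) \<in> N" by blast
  then have "t = tens s x\<^sub>0"
    unfolding tens_def u(2) using u(1) x0_closed
    by (intro free_coset_eqI[OF N.subgroup_axioms]) (simp_all add: keys_frag_of)
  with s(1) show thesis by (rule that)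
qed

text \<open>The element \<open>s g(c x)\<close> is a complete coordinate of a pure tensor. By
  \<open>tens_eq_x0\<close> it determines the tensor; conversely it is the value of an additive map
  that vanishes on the relations, so equal tensors have equal coordinates.\<close>

lemma tens_eq_iff:
  assumes "s \<in> carrier S" "x \<in> carrier P" "t \<in> carrier S" "y \<in> carrier P"
  shows "tens s x = tens t y \<longleftrightarrow> s \<otimes>\<^bsub>S\<^esub> g (c x) = t \<otimes>\<^bsub>S\<^esub> g (c y)"
proof
  assume "s \<otimes>\<^bsub>S\<^esub> g (c x) = t \<otimes>\<^bsub>S\<^esub> g (c y)"
  then show "tens s x = tens t y"
    using assms by (simp only: tens_eq_x0)
next
  let ?f = "\<lambda>(s, x). s \<otimes>\<^bsub>S\<^esub> g (c x)"
  obtain h where h: "h \<in> hom Fr (add_monoid S)"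
    and h_of: "\<And>z. z \<in> carrier S \<times> carrier P \<Longrightarrow> h (frag_of z) = ?f z"
    by (rule comm_group.free_Abelian_group_universal[OF S.a_comm_group, of ?f "carrier S \<times> carrier P"])
      (use g_closed c_closed in auto)
  interpret h: group_hom Fr "add_monoid S" h
    by (intro group_hom.intro group_hom_axioms.intro Fr.is_group S.a_group h)
  have h_diff: "h (u - v) = h u \<ominus>\<^bsub>S\<^esub> h v" if "u \<in> carrier Fr" "v \<in> carrier Fr" for u v
  proof -
    have "h (u - v) = h (u \<otimes>\<^bsub>Fr\<^esub> inv\<^bsub>Fr\<^esub> v)"
      using that by simp
    also have "\<dots> = h u \<ominus>\<^bsub>S\<^esub> h v"
      using h.hom_mult[OF that(1) Fr.inv_closed[OF that(2)]] h.hom_inv[OF that(2)]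
      by (simp add: a_minus_def a_inv_def)
    finally show ?thesis .
  qed
  have gc: "g (c x) \<in> carrier S" if "x \<in> carrier P" for x
    using that by (intro g_closed c_closed)
  \<comment> \<open>The three families vanish by distributivity in \<open>S\<close>, by
    \<open>c_add\<close> and by \<open>c_smult\<close> respectively.\<close>
  have "rels \<subseteq> kernel Fr (add_monoid S) h"
  proof
    fix k assume k: "k \<in> rels"
    then have "h k = \<zero>\<^bsub>S\<^esub>"
    proof (cases rule: rels_cases)
      case (add_left s s' x)
      then show ?thesis
        by (simp add: h_diff h_of keys_diff_subset keys_frag_of gc S.l_distr S.add_minus_minus)
    next
      case (add_right s x x')
      then show ?thesis
        by (simp add: h_diff h_of keys_diff_subset keys_frag_of gc add_closed c_add S.r_distr
            S.add_minus_minus)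
    next
      case (balanced s r x)
      then show ?thesis
        by (simp add: h_diff h_of keys_diff_subset keys_frag_of gc g_closed smult_closed c_smult
            S.m_assoc S.minus_eq S.r_neg)
    qed
    then show "k \<in> kernel Fr (add_monoid S) h"
      using subsetD[OF rels_subset k] by (simp add: kernel_def)
  qed
  then have ker: "N \<subseteq> kernel Fr (add_monoid S) h"
    unfolding tensor_relations_eq by (rule Fr.generate_subgroup_incl[OF _ h.subgroup_kernel])
  assume "tens s x = tens t y"
  then have "frag_of (s, x) \<in> N #>\<^bsub>Fr\<^esub> frag_of (t, y)"
    unfolding tens_def using assms by (metis Fr.rcos_self N.subgroup_axioms frag_of_in_free_Abelian_group SigmaI)
  then obtain n where n: "n \<in> N" "frag_of (s, x) = n + frag_of (t, y)"
    by (auto simp: r_coset_def)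
  then have "n = frag_of (s, x) - frag_of (t, y)" by simp
  moreover have "h n = \<zero>\<^bsub>S\<^esub>"
    using n(1) ker by (auto simp: kernel_def)
  ultimately have "s \<otimes>\<^bsub>S\<^esub> g (c x) \<ominus>\<^bsub>S\<^esub> t \<otimes>\<^bsub>S\<^esub> g (c y) = \<zero>\<^bsub>S\<^esub>"
    using assms by (simp add: h_diff h_of keys_frag_of)
  then show "s \<otimes>\<^bsub>S\<^esub> g (c x) = t \<otimes>\<^bsub>S\<^esub> g (c y)"
    using assms gc S.m_closed S.minus_zero_imp_eq[of "s \<otimes>\<^bsub>S\<^esub> g (c x)" "t \<otimes>\<^bsub>S\<^esub> g (c y)"] by simp
qed

end

text \<open>In the coordinates of \<open>tens_eq_iff\<close> the map takes \<open>s e\<close> to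
  \<open>s w\<close>. Surjectivity, used only at the generator with coordinate \<open>f\<close>,
  gives \<open>u w = f\<close>; injectivity applied to \<open>w u w = w\<close> then gives
  \<open>w u = e\<close>. For the converse, right multiplication by \<open>u\<close> undoes right
  multiplication by \<open>w\<close>.\<close>

lemma tensor_map_iso_iff:
  assumes P: "cyclic_scalar_extension R S g P c x\<^sub>0"
    and Q: "cyclic_scalar_extension R S g Q d y\<^sub>0"
    and \<sigma>: "\<sigma> \<in> left_module_hom R P Q"
  defines "e \<equiv> g (c x\<^sub>0)" and "f \<equiv> g (d y\<^sub>0)" and "w \<equiv> g (d (\<sigma> x\<^sub>0))"
  shows "tensor_map R S g Q \<sigma> \<in> left_module_iso S (tensor_module R S g P) (tensor_module R S g Q) \<longleftrightarrow>
    (\<exists>u\<in>carrier S. u \<otimes>\<^bsub>S\<^esub> e = u \<and> f \<otimes>\<^bsub>S\<^esub> u = u \<and> w \<otimes>\<^bsub>S\<^esub> u = e \<and> u \<otimes>\<^bsub>S\<^esub> w = f)"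
    (is "?tm \<in> _ \<longleftrightarrow> _")
proof -
  interpret P: cyclic_scalar_extension R S g P c x\<^sub>0 by (rule P)
  interpret Q: cyclic_scalar_extension R S g Q d y\<^sub>0 by (rule Q)
  note x0 = P.x0_closed and y0 = Q.x0_closed
  have \<sigma>x0: "\<sigma> x\<^sub>0 \<in> carrier Q"
    using \<sigma> x0 by (auto simp: left_module_hom_def)
  have closed: "e \<in> carrier S" "f \<in> carrier S" "w \<in> carrier S"
    unfolding e_def f_def w_def using x0 y0 \<sigma>x0 by (auto intro!: P.g_closed P.c_closed Q.c_closed)
  have ee: "e \<otimes>\<^bsub>S\<^esub> e = e"
    unfolding e_def using P.c_smult[OF P.c_closed[OF x0] x0] P.c_x0[OF x0] by simp
  have ff: "f \<otimes>\<^bsub>S\<^esub> f = f"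
    unfolding f_def using Q.c_smult[OF Q.c_closed[OF y0] y0] Q.c_x0[OF y0] by simp
  have wf: "w \<otimes>\<^bsub>S\<^esub> f = w"
    unfolding w_def f_def using Q.c_smult[OF Q.c_closed[OF \<sigma>x0] y0] Q.c_x0[OF \<sigma>x0] by simp
  \<comment> \<open>Linearity of \<sigma> at
    \<open>x\<^sub>0 = c x\<^sub>0 \<odot> x\<^sub>0\<close>; together with \<open>wf\<close> it
    places \<open>w\<close> in \<open>e S f\<close>.\<close>
  have "\<sigma> x\<^sub>0 = c x\<^sub>0 \<odot>\<^bsub>Q\<^esub> \<sigma> x\<^sub>0"
    using \<sigma> x0 P.c_closed[OF x0] P.c_x0[OF x0] unfolding left_module_hom_def mem_Collect_eq by metis
  then have ew: "e \<otimes>\<^bsub>S\<^esub> w = w"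
    unfolding w_def e_def using Q.c_smult[OF P.c_closed[OF x0] \<sigma>x0] by simp
  have tm: "?tm (P.tens s x\<^sub>0) = Q.tens s (\<sigma> x\<^sub>0)" if "s \<in> carrier S" for s
    by (rule P.tensor_map_tens[OF Q.scalar_extension_axioms \<sigma> that x0])
  have hom: "?tm \<in> left_module_hom S P.Tens Q.Tens"
    unfolding left_module_hom_def mem_Collect_eq
  proof (intro conjI funcsetI ballI)
    fix t assume "t \<in> carrier P.Tens"
    then obtain s where s: "s \<in> carrier S" "t = P.tens s x\<^sub>0"
      by (rule P.tensor_pure)
    show "?tm t \<in> carrier Q.Tens"
      using s \<sigma>x0 by (simp add: tm Q.tens_closed)
    fix t' assume "t' \<in> carrier P.Tens"
    then obtain s' where s': "s' \<in> carrier S" "t' = P.tens s' x\<^sub>0"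
      by (rule P.tensor_pure)
    show "?tm (t \<oplus>\<^bsub>P.Tens\<^esub> t') = ?tm t \<oplus>\<^bsub>Q.Tens\<^esub> ?tm t'"
      using s s' \<sigma>x0 x0 by (simp add: tm P.tens_add Q.tens_add)
  next
    fix r t assume r: "r \<in> carrier S" and "t \<in> carrier P.Tens"
    then obtain s where s: "s \<in> carrier S" "t = P.tens s x\<^sub>0"
      using P.tensor_pure by metis
    show "?tm (r \<odot>\<^bsub>P.Tens\<^esub> t) = r \<odot>\<^bsub>Q.Tens\<^esub> ?tm t"
      using r s \<sigma>x0 x0 by (simp add: tm P.tensor_smult Q.tensor_smult)
  qed
  have eq_P: "P.tens s x\<^sub>0 = P.tens s' x\<^sub>0 \<longleftrightarrow> s \<otimes>\<^bsub>S\<^esub> e = s' \<otimes>\<^bsub>S\<^esub> e"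
    if "s \<in> carrier S" "s' \<in> carrier S" for s s'
    unfolding e_def using that x0 by (simp add: P.tens_eq_iff)
  have eq_Q: "Q.tens s (\<sigma> x\<^sub>0) = Q.tens s' (\<sigma> x\<^sub>0) \<longleftrightarrow> s \<otimes>\<^bsub>S\<^esub> w = s' \<otimes>\<^bsub>S\<^esub> w"
    "Q.tens s (\<sigma> x\<^sub>0) = Q.tens s' y\<^sub>0 \<longleftrightarrow> s \<otimes>\<^bsub>S\<^esub> w = s' \<otimes>\<^bsub>S\<^esub> f"
    if "s \<in> carrier S" "s' \<in> carrier S" for s s'
    unfolding w_def f_def using that \<sigma>x0 y0 by (simp_all add: Q.tens_eq_iff)
  show ?thesis
  proof
    assume "?tm \<in> left_module_iso S P.Tens Q.Tens"
    then have inj: "inj_on ?tm (carrier P.Tens)" and surj: "?tm ` carrier P.Tens = carrier Q.Tens"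
      unfolding left_module_iso_def bij_betw_def by simp_all
    have "Q.tens \<one>\<^bsub>S\<^esub> y\<^sub>0 \<in> ?tm ` carrier P.Tens"
      unfolding surj using y0 by (intro Q.tens_closed P.S.one_closed)
    then obtain t where t: "t \<in> carrier P.Tens" "Q.tens \<one>\<^bsub>S\<^esub> y\<^sub>0 = ?tm t"
      by (rule imageE)
    from t(1) obtain s where s: "s \<in> carrier S" "t = P.tens s x\<^sub>0"
      by (rule P.tensor_pure)
    have sw: "s \<otimes>\<^bsub>S\<^esub> w = f"
      using t(2) s closed eq_Q(2)[of s "\<one>\<^bsub>S\<^esub>"] by (simp add: tm)
    \<comment> \<open>Cutting \<open>s\<close> down to \<open>f s e\<close> gives the two
      normalizing equations and keeps the product with \<open>w\<close>, since
      \<open>f s e w = f s w = f f = f\<close>.\<close>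
    define u where "u = f \<otimes>\<^bsub>S\<^esub> s \<otimes>\<^bsub>S\<^esub> e"
    have u: "u \<in> carrier S" "u \<otimes>\<^bsub>S\<^esub> e = u" "f \<otimes>\<^bsub>S\<^esub> u = u"
      unfolding u_def using closed s(1) ee
      by (simp_all add: P.S.m_assoc) (simp add: P.S.m_assoc[symmetric] ff)
    have uw: "u \<otimes>\<^bsub>S\<^esub> w = f"
      unfolding u_def using closed s(1) sw ff ew by (simp add: P.S.m_assoc)
    have wu: "w \<otimes>\<^bsub>S\<^esub> u \<in> carrier S"
      using u(1) closed by simp
    have "w \<otimes>\<^bsub>S\<^esub> u \<otimes>\<^bsub>S\<^esub> w = \<one>\<^bsub>S\<^esub> \<otimes>\<^bsub>S\<^esub> w"
      using closed u(1) uw wf by (simp add: P.S.m_assoc)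
    then have "?tm (P.tens (w \<otimes>\<^bsub>S\<^esub> u) x\<^sub>0) = ?tm (P.tens \<one>\<^bsub>S\<^esub> x\<^sub>0)"
      using wu by (simp only: tm P.S.one_closed eq_Q)
    then have "P.tens (w \<otimes>\<^bsub>S\<^esub> u) x\<^sub>0 = P.tens \<one>\<^bsub>S\<^esub> x\<^sub>0"
      using wu x0 by (intro inj_onD[OF inj] P.tens_closed P.S.one_closed)
    then have "w \<otimes>\<^bsub>S\<^esub> u = e"
      using wu closed u by (simp add: eq_P P.S.m_assoc)
    with u uw show "\<exists>u\<in>carrier S. u \<otimes>\<^bsub>S\<^esub> e = u \<and> f \<otimes>\<^bsub>S\<^esub> u = u \<and> w \<otimes>\<^bsub>S\<^esub> u = e \<and> u \<otimes>\<^bsub>S\<^esub> w = f"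
      by (intro bexI[of _ u] conjI)
  next
    assume "\<exists>u\<in>carrier S. u \<otimes>\<^bsub>S\<^esub> e = u \<and> f \<otimes>\<^bsub>S\<^esub> u = u \<and> w \<otimes>\<^bsub>S\<^esub> u = e \<and> u \<otimes>\<^bsub>S\<^esub> w = f"
    then obtain u where u: "u \<in> carrier S" "w \<otimes>\<^bsub>S\<^esub> u = e" "u \<otimes>\<^bsub>S\<^esub> w = f"
      by (elim bexE conjE)
    have "inj_on ?tm (carrier P.Tens)"
    proof (rule inj_onI)
      fix t t' assume "t \<in> carrier P.Tens" "t' \<in> carrier P.Tens" and eq: "?tm t = ?tm t'"
      then obtain s s' where s: "s \<in> carrier S" "t = P.tens s x\<^sub>0" "s' \<in> carrier S" "t' = P.tens s' x\<^sub>0"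
        using P.tensor_pure by metis
      \<comment> \<open>Equal images mean \<open>s w = s' w\<close>; multiplied by \<open>u\<close>,
        this becomes \<open>s e = s' e\<close>, the equality of coordinates in the source.\<close>
      then have "s \<otimes>\<^bsub>S\<^esub> w \<otimes>\<^bsub>S\<^esub> u = s' \<otimes>\<^bsub>S\<^esub> w \<otimes>\<^bsub>S\<^esub> u"
        using eq by (simp add: tm eq_Q)
      then show "t = t'"
        using s closed u by (simp add: eq_P P.S.m_assoc)
    qed
    moreover have "?tm ` carrier P.Tens = carrier Q.Tens"
    proof (intro equalityI image_subsetI subsetI)
      show "?tm t \<in> carrier Q.Tens" if "t \<in> carrier P.Tens" for t
        using hom that by (auto simp: left_module_hom_def)
      fix t assume "t \<in> carrier Q.Tens"
      then obtain s where s: "s \<in> carrier S" "t = Q.tens s y\<^sub>0"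
        by (rule Q.tensor_pure)
      \<comment> \<open>The preimage is \<open>s u\<close>, because
        \<open>s u w = s f\<close>.\<close>
      have "t = ?tm (P.tens (s \<otimes>\<^bsub>S\<^esub> u) x\<^sub>0)"
        using s closed u eq_Q(2)[of "s \<otimes>\<^bsub>S\<^esub> u" s] by (simp add: tm P.S.m_assoc)
      then show "t \<in> ?tm ` carrier P.Tens"
        by (rule image_eqI) (use s u x0 in \<open>simp add: P.tens_closed\<close>)
    qed
    ultimately show "?tm \<in> left_module_iso S P.Tens Q.Tens"
      unfolding left_module_iso_def bij_betw_def using hom by simp
  qed
qed

section \<open>Corner rings and matrix rings\<close>

text \<open>For an idempotent \<open>e\<close> this is \<open>e S e\<close>. Describing its elements
  as those fixed by \<open>e\<close> on both sides makes membership a pair of equations.\<close>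

definition corner_ring :: "('s, 'w) ring_scheme \<Rightarrow> 's \<Rightarrow> ('s, 'w) ring_scheme" where
  "corner_ring S e =
    S\<lparr>carrier := {x \<in> carrier S. e \<otimes>\<^bsub>S\<^esub> x = x \<and> x \<otimes>\<^bsub>S\<^esub> e = x}, one := e\<rparr>"

lemma corner_ring_simps [simp]:
  "x \<in> carrier (corner_ring S e) \<longleftrightarrow> x \<in> carrier S \<and> e \<otimes>\<^bsub>S\<^esub> x = x \<and> x \<otimes>\<^bsub>S\<^esub> e = x"
  "x \<otimes>\<^bsub>corner_ring S e\<^esub> y = x \<otimes>\<^bsub>S\<^esub> y"
  "x \<oplus>\<^bsub>corner_ring S e\<^esub> y = x \<oplus>\<^bsub>S\<^esub> y"
  "\<one>\<^bsub>corner_ring S e\<^esub> = e"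
  "\<zero>\<^bsub>corner_ring S e\<^esub> = \<zero>\<^bsub>S\<^esub>"
  by (simp_all add: corner_ring_def)

lemma (in ring) ring_corner_ring:
  assumes e: "e \<in> carrier R" "e \<otimes> e = e"
  shows "ring (corner_ring R e)"
proof (rule ringI)
  show "abelian_group (corner_ring R e)"
  proof (rule abelian_groupI)
    fix x assume "x \<in> carrier (corner_ring R e)"
    then show "\<exists>y\<in>carrier (corner_ring R e). y \<oplus>\<^bsub>corner_ring R e\<^esub> x = \<zero>\<^bsub>corner_ring R e\<^esub>"
      using e by (intro bexI[of _ "\<ominus> x"]) (simp_all add: l_neg r_minus l_minus)
  qed (use e in \<open>simp_all add: l_distr r_distr a_ac\<close>)
  show "Group.monoid (corner_ring R e)"
  proof (rule monoidI)
    fix x y assume xy: "x \<in> carrier (corner_ring R e)" "y \<in> carrier (corner_ring R e)"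
    then have "e \<otimes> (x \<otimes> y) = x \<otimes> y"
      using e m_assoc[of e x y] by simp
    with xy show "x \<otimes>\<^bsub>corner_ring R e\<^esub> y \<in> carrier (corner_ring R e)"
      using e by (simp add: m_assoc)
  qed (use e in \<open>simp_all add: m_assoc\<close>)
qed (simp_all add: l_distr r_distr)

section \<open>Rings of two-by-two matrices\<close>

lemma matrix2_ring_simps [simp]:
  "carrier (matrix2_ring T) = carrier T \<times> carrier T \<times> carrier T \<times> carrier T"
  "(x, y, z, w) \<otimes>\<^bsub>matrix2_ring T\<^esub> (x', y', z', w') =
    (x \<otimes>\<^bsub>T\<^esub> x' \<oplus>\<^bsub>T\<^esub> y \<otimes>\<^bsub>T\<^esub> z', x \<otimes>\<^bsub>T\<^esub> y' \<oplus>\<^bsub>T\<^esub> y \<otimes>\<^bsub>T\<^esub> w',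
     z \<otimes>\<^bsub>T\<^esub> x' \<oplus>\<^bsub>T\<^esub> w \<otimes>\<^bsub>T\<^esub> z', z \<otimes>\<^bsub>T\<^esub> y' \<oplus>\<^bsub>T\<^esub> w \<otimes>\<^bsub>T\<^esub> w')"
  "(x, y, z, w) \<oplus>\<^bsub>matrix2_ring T\<^esub> (x', y', z', w') =
    (x \<oplus>\<^bsub>T\<^esub> x', y \<oplus>\<^bsub>T\<^esub> y', z \<oplus>\<^bsub>T\<^esub> z', w \<oplus>\<^bsub>T\<^esub> w')"
  "\<one>\<^bsub>matrix2_ring T\<^esub> = (\<one>\<^bsub>T\<^esub>, \<zero>\<^bsub>T\<^esub>, \<zero>\<^bsub>T\<^esub>, \<one>\<^bsub>T\<^esub>)"
  "\<zero>\<^bsub>matrix2_ring T\<^esub> = (\<zero>\<^bsub>T\<^esub>, \<zero>\<^bsub>T\<^esub>, \<zero>\<^bsub>T\<^esub>, \<zero>\<^bsub>T\<^esub>)"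
  by (simp_all add: matrix2_ring_def)

lemma (in ring) ring_matrix2_ring: "ring (matrix2_ring R)"
proof (rule ringI)
  show "abelian_group (matrix2_ring R)"
  proof (rule abelian_groupI)
    fix X assume "X \<in> carrier (matrix2_ring R)"
    then obtain x y z w where X: "X = (x, y, z, w)"
      and "x \<in> carrier R" "y \<in> carrier R" "z \<in> carrier R" "w \<in> carrier R"
      by auto
    then show "\<exists>Y\<in>carrier (matrix2_ring R). Y \<oplus>\<^bsub>matrix2_ring R\<^esub> X = \<zero>\<^bsub>matrix2_ring R\<^esub>"
      by (intro bexI[of _ "(\<ominus> x, \<ominus> y, \<ominus> z, \<ominus> w)"]) (simp_all add: l_neg)
  qed (auto simp: a_ac)
  show "Group.monoid (matrix2_ring R)"
    by (rule monoidI) (auto simp: l_distr r_distr m_assoc a_ac)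
qed (auto simp: l_distr r_distr a_ac)

text \<open>
  The hypotheses say that \<open>e\<close>, \<open>w\<close>, \<open>u\<close>, \<open>f\<close> are the images of the matrix units, in the order
  \<open>(1,1)\<close>, \<open>(1,2)\<close>, \<open>(2,1)\<close>, \<open>(2,2)\<close>.
\<close>

lemma (in ring) matrix2_ring_hom:
  fixes S :: "('s, 'y) ring_scheme"
  assumes S: "ring S" and closed: "e \<in> carrier S" "f \<in> carrier S" "u \<in> carrier S" "w \<in> carrier S"
    and idem: "e \<oplus>\<^bsub>S\<^esub> f = \<one>\<^bsub>S\<^esub>" "e \<otimes>\<^bsub>S\<^esub> f = \<zero>\<^bsub>S\<^esub>" "f \<otimes>\<^bsub>S\<^esub> e = \<zero>\<^bsub>S\<^esub>"
    and u: "u \<otimes>\<^bsub>S\<^esub> e = u" "f \<otimes>\<^bsub>S\<^esub> u = u" and w: "e \<otimes>\<^bsub>S\<^esub> w = w" "w \<otimes>\<^bsub>S\<^esub> f = w"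
    and wu: "w \<otimes>\<^bsub>S\<^esub> u = e" and uw: "u \<otimes>\<^bsub>S\<^esub> w = f"
    and \<theta>: "\<theta> \<in> ring_hom R (corner_ring S e)"
  shows "(\<lambda>(x, y, z, t). \<theta> x \<oplus>\<^bsub>S\<^esub> \<theta> y \<otimes>\<^bsub>S\<^esub> w \<oplus>\<^bsub>S\<^esub> u \<otimes>\<^bsub>S\<^esub> \<theta> z \<oplus>\<^bsub>S\<^esub> u \<otimes>\<^bsub>S\<^esub> \<theta> t \<otimes>\<^bsub>S\<^esub> w)
    \<in> ring_hom (matrix2_ring R) S"
proof -
  interpret S: ring S by (rule S)
  have ee: "e \<otimes>\<^bsub>S\<^esub> e = e"
    using wu closed w(1) S.m_assoc[of e w u] by simp
  have corner: "\<theta> x \<in> carrier S" "e \<otimes>\<^bsub>S\<^esub> \<theta> x = \<theta> x" "\<theta> x \<otimes>\<^bsub>S\<^esub> e = \<theta> x" if "x \<in> carrier R" for x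
    using ring_hom_closed[OF \<theta> that] by simp_all
  have hom: "\<theta> (x \<otimes> y) = \<theta> x \<otimes>\<^bsub>S\<^esub> \<theta> y" "\<theta> (x \<oplus> y) = \<theta> x \<oplus>\<^bsub>S\<^esub> \<theta> y"
    if "x \<in> carrier R" "y \<in> carrier R" for x y
    using ring_hom_mult[OF \<theta> that] ring_hom_add[OF \<theta> that] by simp_all
  have \<theta>_one: "\<theta> \<one> = e"
    using ring_hom_one[OF \<theta>] by simp
  have \<theta>_zero: "\<theta> \<zero> = \<zero>\<^bsub>S\<^esub>"
    using ring_hom_zero[OF \<theta> ring_axioms S.ring_corner_ring[OF closed(1) ee]] by simp
  \<comment> \<open>The left factor ends in \<open>e\<close>, the right one begins with
    \<open>f\<close>, and \<open>e f\<close> is zero.\<close>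
  have \<theta>u: "\<theta> x \<otimes>\<^bsub>S\<^esub> u = \<zero>\<^bsub>S\<^esub>" if "x \<in> carrier R" for x
  proof -
    have "\<theta> x \<otimes>\<^bsub>S\<^esub> u = \<theta> x \<otimes>\<^bsub>S\<^esub> e \<otimes>\<^bsub>S\<^esub> (f \<otimes>\<^bsub>S\<^esub> u)"
      using that by (simp add: corner u)
    also have "\<dots> = \<theta> x \<otimes>\<^bsub>S\<^esub> (e \<otimes>\<^bsub>S\<^esub> f) \<otimes>\<^bsub>S\<^esub> u"
      using that closed by (simp add: S.m_assoc corner(1))
    finally show ?thesis
      using that closed by (simp add: idem corner(1))
  qed
  have w\<theta>: "w \<otimes>\<^bsub>S\<^esub> \<theta> x = \<zero>\<^bsub>S\<^esub>" if "x \<in> carrier R" for x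
  proof -
    have "w \<otimes>\<^bsub>S\<^esub> \<theta> x = w \<otimes>\<^bsub>S\<^esub> f \<otimes>\<^bsub>S\<^esub> (e \<otimes>\<^bsub>S\<^esub> \<theta> x)"
      using that by (simp add: corner w)
    also have "\<dots> = w \<otimes>\<^bsub>S\<^esub> (f \<otimes>\<^bsub>S\<^esub> e) \<otimes>\<^bsub>S\<^esub> \<theta> x"
      using that closed by (simp add: S.m_assoc corner(1))
    finally show ?thesis
      using that closed by (simp add: idem corner(1))
  qed
  \<comment> \<open>The same rules with a trailing factor, so that they also apply inside products
    nested to the right by \<open>m_assoc\<close>.\<close>
  have cancel: "\<theta> x \<otimes>\<^bsub>S\<^esub> (u \<otimes>\<^bsub>S\<^esub> s) = \<zero>\<^bsub>S\<^esub>" "w \<otimes>\<^bsub>S\<^esub> (\<theta> x \<otimes>\<^bsub>S\<^esub> s) = \<zero>\<^bsub>S\<^esub>"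
    "w \<otimes>\<^bsub>S\<^esub> (u \<otimes>\<^bsub>S\<^esub> s) = e \<otimes>\<^bsub>S\<^esub> s" "e \<otimes>\<^bsub>S\<^esub> (\<theta> x \<otimes>\<^bsub>S\<^esub> s) = \<theta> x \<otimes>\<^bsub>S\<^esub> s"
    if "x \<in> carrier R" "s \<in> carrier S" for x s
    using that closed \<theta>u w\<theta> wu corner by (simp_all add: S.m_assoc[symmetric])
  show ?thesis
  proof (rule ring_hom_memI)
    fix X assume "X \<in> carrier (matrix2_ring R)"
    then obtain x y z t where X: "X = (x, y, z, t)"
      "x \<in> carrier R" "y \<in> carrier R" "z \<in> carrier R" "t \<in> carrier R" by auto
    then show "(case X of (x, y, z, t) \<Rightarrow> \<theta> x \<oplus>\<^bsub>S\<^esub> \<theta> y \<otimes>\<^bsub>S\<^esub> w \<oplus>\<^bsub>S\<^esub> u \<otimes>\<^bsub>S\<^esub> \<theta> z \<oplus>\<^bsub>S\<^esub>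
        u \<otimes>\<^bsub>S\<^esub> \<theta> t \<otimes>\<^bsub>S\<^esub> w) \<in> carrier S"
      using closed corner(1) by simp
    fix Y assume "Y \<in> carrier (matrix2_ring R)"
    then obtain x' y' z' t' where Y: "Y = (x', y', z', t')"
      "x' \<in> carrier R" "y' \<in> carrier R" "z' \<in> carrier R" "t' \<in> carrier R" by auto
    note XY = X Y closed corner(1)
    show "(case X \<oplus>\<^bsub>matrix2_ring R\<^esub> Y of (x, y, z, t) \<Rightarrow> \<theta> x \<oplus>\<^bsub>S\<^esub> \<theta> y \<otimes>\<^bsub>S\<^esub> w \<oplus>\<^bsub>S\<^esub>
        u \<otimes>\<^bsub>S\<^esub> \<theta> z \<oplus>\<^bsub>S\<^esub> u \<otimes>\<^bsub>S\<^esub> \<theta> t \<otimes>\<^bsub>S\<^esub> w) =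
      (case X of (x, y, z, t) \<Rightarrow> \<theta> x \<oplus>\<^bsub>S\<^esub> \<theta> y \<otimes>\<^bsub>S\<^esub> w \<oplus>\<^bsub>S\<^esub> u \<otimes>\<^bsub>S\<^esub> \<theta> z \<oplus>\<^bsub>S\<^esub>
        u \<otimes>\<^bsub>S\<^esub> \<theta> t \<otimes>\<^bsub>S\<^esub> w) \<oplus>\<^bsub>S\<^esub>
      (case Y of (x, y, z, t) \<Rightarrow> \<theta> x \<oplus>\<^bsub>S\<^esub> \<theta> y \<otimes>\<^bsub>S\<^esub> w \<oplus>\<^bsub>S\<^esub> u \<otimes>\<^bsub>S\<^esub> \<theta> z \<oplus>\<^bsub>S\<^esub>
        u \<otimes>\<^bsub>S\<^esub> \<theta> t \<otimes>\<^bsub>S\<^esub> w)"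
      using XY by (simp add: hom S.l_distr S.r_distr S.a_ac)
    \<comment> \<open>Of the sixteen products of summands, eight vanish because \<theta> meets
      \<open>u\<close> or \<open>w\<close> meets \<theta>. In four of the others \<open>w u\<close>
      contracts to \<open>e\<close>, which the corner absorbs.\<close>
    show "(case X \<otimes>\<^bsub>matrix2_ring R\<^esub> Y of (x, y, z, t) \<Rightarrow> \<theta> x \<oplus>\<^bsub>S\<^esub> \<theta> y \<otimes>\<^bsub>S\<^esub> w \<oplus>\<^bsub>S\<^esub>
        u \<otimes>\<^bsub>S\<^esub> \<theta> z \<oplus>\<^bsub>S\<^esub> u \<otimes>\<^bsub>S\<^esub> \<theta> t \<otimes>\<^bsub>S\<^esub> w) =
      (case X of (x, y, z, t) \<Rightarrow> \<theta> x \<oplus>\<^bsub>S\<^esub> \<theta> y \<otimes>\<^bsub>S\<^esub> w \<oplus>\<^bsub>S\<^esub> u \<otimes>\<^bsub>S\<^esub> \<theta> z \<oplus>\<^bsub>S\<^esub>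
        u \<otimes>\<^bsub>S\<^esub> \<theta> t \<otimes>\<^bsub>S\<^esub> w) \<otimes>\<^bsub>S\<^esub>
      (case Y of (x, y, z, t) \<Rightarrow> \<theta> x \<oplus>\<^bsub>S\<^esub> \<theta> y \<otimes>\<^bsub>S\<^esub> w \<oplus>\<^bsub>S\<^esub> u \<otimes>\<^bsub>S\<^esub> \<theta> z \<oplus>\<^bsub>S\<^esub>
        u \<otimes>\<^bsub>S\<^esub> \<theta> t \<otimes>\<^bsub>S\<^esub> w)"
      using XY by (simp add: hom S.l_distr S.r_distr S.m_assoc cancel \<theta>u w\<theta> corner(2) S.a_ac)
  next
    show "(case \<one>\<^bsub>matrix2_ring R\<^esub> of (x, y, z, t) \<Rightarrow> \<theta> x \<oplus>\<^bsub>S\<^esub> \<theta> y \<otimes>\<^bsub>S\<^esub> w \<oplus>\<^bsub>S\<^esub>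
        u \<otimes>\<^bsub>S\<^esub> \<theta> z \<oplus>\<^bsub>S\<^esub> u \<otimes>\<^bsub>S\<^esub> \<theta> t \<otimes>\<^bsub>S\<^esub> w) = \<one>\<^bsub>S\<^esub>"
      using closed by (simp add: \<theta>_one \<theta>_zero u uw idem)
  qed
qed

section \<open>The columns of the triangular ring\<close>

lemma triangular_ring_simps [simp]:
  "carrier (triangular_ring A B M) = carrier A \<times> carrier M \<times> carrier B"
  "(a, m, b) \<otimes>\<^bsub>triangular_ring A B M\<^esub> (a', m', b') =
    (a \<otimes>\<^bsub>A\<^esub> a', a \<odot>\<^bsub>M\<^esub> m' \<oplus>\<^bsub>M\<^esub> m \<triangleleft>\<^bsub>M\<^esub> b', b \<otimes>\<^bsub>B\<^esub> b')"
  "(a, m, b) \<oplus>\<^bsub>triangular_ring A B M\<^esub> (a', m', b') = (a \<oplus>\<^bsub>A\<^esub> a', m \<oplus>\<^bsub>M\<^esub> m', b \<oplus>\<^bsub>B\<^esub> b')"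
  "\<one>\<^bsub>triangular_ring A B M\<^esub> = (\<one>\<^bsub>A\<^esub>, \<zero>\<^bsub>M\<^esub>, \<one>\<^bsub>B\<^esub>)"
  "\<zero>\<^bsub>triangular_ring A B M\<^esub> = (\<zero>\<^bsub>A\<^esub>, \<zero>\<^bsub>M\<^esub>, \<zero>\<^bsub>B\<^esub>)"
  by (simp_all add: triangular_ring_def)

lemma column1_simps [simp]:
  "carrier (column1 A) = carrier A"
  "x \<oplus>\<^bsub>column1 A\<^esub> y = x \<oplus>\<^bsub>A\<^esub> y"
  "(a, m, b) \<odot>\<^bsub>column1 A\<^esub> x = a \<otimes>\<^bsub>A\<^esub> x"
  by (simp_all add: column1_def)

lemma column2_simps [simp]:
  "carrier (column2 B M) = carrier M \<times> carrier B"
  "(m, b) \<oplus>\<^bsub>column2 B M\<^esub> (m', b') = (m \<oplus>\<^bsub>M\<^esub> m', b \<oplus>\<^bsub>B\<^esub> b')"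
  "(a, m, b) \<odot>\<^bsub>column2 B M\<^esub> (m', b') = (a \<odot>\<^bsub>M\<^esub> m' \<oplus>\<^bsub>M\<^esub> m \<triangleleft>\<^bsub>M\<^esub> b', b \<otimes>\<^bsub>B\<^esub> b')"
  by (simp_all add: column2_def)

context bimodule
begin

lemma smult_zeros [simp]:
  "a \<in> carrier A \<Longrightarrow> a \<odot>\<^bsub>M\<^esub> \<zero>\<^bsub>M\<^esub> = \<zero>\<^bsub>M\<^esub>"
  "m \<in> carrier M \<Longrightarrow> \<zero>\<^bsub>A\<^esub> \<odot>\<^bsub>M\<^esub> m = \<zero>\<^bsub>M\<^esub>"
  "b \<in> carrier B \<Longrightarrow> \<zero>\<^bsub>M\<^esub> \<triangleleft>\<^bsub>M\<^esub> b = \<zero>\<^bsub>M\<^esub>"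
  "m \<in> carrier M \<Longrightarrow> m \<triangleleft>\<^bsub>M\<^esub> \<zero>\<^bsub>B\<^esub> = \<zero>\<^bsub>M\<^esub>"
  using lsmult_r_distr[of a "\<zero>\<^bsub>M\<^esub>" "\<zero>\<^bsub>M\<^esub>"] lsmult_closed[of a "\<zero>\<^bsub>M\<^esub>"]
    lsmult_l_distr[of "\<zero>\<^bsub>A\<^esub>" "\<zero>\<^bsub>A\<^esub>" m] lsmult_closed[of "\<zero>\<^bsub>A\<^esub>" m]
    rsmult_l_distr[of "\<zero>\<^bsub>M\<^esub>" "\<zero>\<^bsub>M\<^esub>" b] rsmult_closed[of "\<zero>\<^bsub>M\<^esub>" b]
    rsmult_r_distr[of m "\<zero>\<^bsub>B\<^esub>" "\<zero>\<^bsub>B\<^esub>"] rsmult_closed[of m "\<zero>\<^bsub>B\<^esub>"]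
  by simp_all

text \<open>The column is the left ideal generated by the first diagonal idempotent, and the
  embedding sends the generator to that idempotent.\<close>

lemma cyclic_column1:
  assumes S: "ring S" and g: "g \<in> ring_hom (triangular_ring A B M) S"
  shows "cyclic_scalar_extension (triangular_ring A B M) S g (column1 A)
    (\<lambda>a. (a, \<zero>\<^bsub>M\<^esub>, \<zero>\<^bsub>B\<^esub>)) \<one>\<^bsub>A\<^esub>"
proof (intro cyclic_scalar_extension.intro scalar_extension.intro
    cyclic_scalar_extension_axioms.intro S)
  fix x y assume "x \<in> carrier (column1 A)" "y \<in> carrier (column1 A)"
  then show "g (x \<oplus>\<^bsub>column1 A\<^esub> y, \<zero>\<^bsub>M\<^esub>, \<zero>\<^bsub>B\<^esub>) = g (x, \<zero>\<^bsub>M\<^esub>, \<zero>\<^bsub>B\<^esub>) \<oplus>\<^bsub>S\<^esub> g (y, \<zero>\<^bsub>M\<^esub>, \<zero>\<^bsub>B\<^esub>)"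
    using ring_hom_add[OF g, of "(x, \<zero>\<^bsub>M\<^esub>, \<zero>\<^bsub>B\<^esub>)" "(y, \<zero>\<^bsub>M\<^esub>, \<zero>\<^bsub>B\<^esub>)"] by simp
next
  fix r x assume r: "r \<in> carrier (triangular_ring A B M)" and x: "x \<in> carrier (column1 A)"
  obtain a m b where "r = (a, m, b)" "a \<in> carrier A" "m \<in> carrier M" "b \<in> carrier B"
    using r by auto
  then show "g (r \<odot>\<^bsub>column1 A\<^esub> x, \<zero>\<^bsub>M\<^esub>, \<zero>\<^bsub>B\<^esub>) = g r \<otimes>\<^bsub>S\<^esub> g (x, \<zero>\<^bsub>M\<^esub>, \<zero>\<^bsub>B\<^esub>)"
    using ring_hom_mult[OF g r, of "(x, \<zero>\<^bsub>M\<^esub>, \<zero>\<^bsub>B\<^esub>)"] x by simp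
qed (auto simp: ring_hom_closed[OF g])

text \<open>Here the left ideal is generated by the second diagonal idempotent; it contains the
  entries from \<open>M\<close> because these stand in the second column.\<close>

lemma cyclic_column2:
  assumes S: "ring S" and g: "g \<in> ring_hom (triangular_ring A B M) S"
  shows "cyclic_scalar_extension (triangular_ring A B M) S g (column2 B M)
    (\<lambda>(m, b). (\<zero>\<^bsub>A\<^esub>, m, b)) (\<zero>\<^bsub>M\<^esub>, \<one>\<^bsub>B\<^esub>)"
proof (intro cyclic_scalar_extension.intro scalar_extension.intro
    cyclic_scalar_extension_axioms.intro S)
  fix x y assume "x \<in> carrier (column2 B M)" "y \<in> carrier (column2 B M)"
  then show "g (case x \<oplus>\<^bsub>column2 B M\<^esub> y of (m, b) \<Rightarrow> (\<zero>\<^bsub>A\<^esub>, m, b)) =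
      g (case x of (m, b) \<Rightarrow> (\<zero>\<^bsub>A\<^esub>, m, b)) \<oplus>\<^bsub>S\<^esub> g (case y of (m, b) \<Rightarrow> (\<zero>\<^bsub>A\<^esub>, m, b))"
    using ring_hom_add[OF g, of "(\<zero>\<^bsub>A\<^esub>, x)" "(\<zero>\<^bsub>A\<^esub>, y)"] by (cases x; cases y) simp
next
  fix r x assume r: "r \<in> carrier (triangular_ring A B M)" and x: "x \<in> carrier (column2 B M)"
  obtain a m b where "r = (a, m, b)" "a \<in> carrier A" "m \<in> carrier M" "b \<in> carrier B"
    using r by auto
  then show "g (case r \<odot>\<^bsub>column2 B M\<^esub> x of (m, b) \<Rightarrow> (\<zero>\<^bsub>A\<^esub>, m, b)) =
      g r \<otimes>\<^bsub>S\<^esub> g (case x of (m, b) \<Rightarrow> (\<zero>\<^bsub>A\<^esub>, m, b))"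
    using ring_hom_mult[OF g r, of "(\<zero>\<^bsub>A\<^esub>, x)"] x by (cases x) simp
qed (auto simp: ring_hom_closed[OF g] lsmult_closed rsmult_closed rsmult_one)

text \<open>The embedding of the second column sends \<open>\<sigma> \<one>\<close>, that is
  \<open>(p, \<zero>)\<close>, to the matrix whose only non-zero entry is \<open>p\<close>; its
  image is the \<open>w\<close> of \<open>tensor_map_iso_iff\<close>.\<close>

lemma sigma_inverting_iff:
  assumes S: "ring S" and g: "g \<in> ring_hom (triangular_ring A B M) S"
    and \<sigma>: "\<sigma> \<in> left_module_hom (triangular_ring A B M) (column1 A) (column2 B M)"
    and p: "\<sigma> \<one>\<^bsub>A\<^esub> = (p, \<zero>\<^bsub>B\<^esub>)"
  shows "sigma_inverting (triangular_ring A B M) (column1 A) (column2 B M) \<sigma> S g \<longleftrightarrow>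
    (\<exists>u\<in>carrier S. u \<otimes>\<^bsub>S\<^esub> g (\<one>\<^bsub>A\<^esub>, \<zero>\<^bsub>M\<^esub>, \<zero>\<^bsub>B\<^esub>) = u \<and> g (\<zero>\<^bsub>A\<^esub>, \<zero>\<^bsub>M\<^esub>, \<one>\<^bsub>B\<^esub>) \<otimes>\<^bsub>S\<^esub> u = u \<and>
      g (\<zero>\<^bsub>A\<^esub>, p, \<zero>\<^bsub>B\<^esub>) \<otimes>\<^bsub>S\<^esub> u = g (\<one>\<^bsub>A\<^esub>, \<zero>\<^bsub>M\<^esub>, \<zero>\<^bsub>B\<^esub>) \<and>
      u \<otimes>\<^bsub>S\<^esub> g (\<zero>\<^bsub>A\<^esub>, p, \<zero>\<^bsub>B\<^esub>) = g (\<zero>\<^bsub>A\<^esub>, \<zero>\<^bsub>M\<^esub>, \<one>\<^bsub>B\<^esub>))"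
  unfolding sigma_inverting_def using S g p
    tensor_map_iso_iff[OF cyclic_column1[OF S g] cyclic_column2[OF S g] \<sigma>] by simp

end

section \<open>The universal localization\<close>

context pointed_bimodule
begin

text \<open>The mixed relations of \<open>T\<close> handle the upper right entry. The diagonal
  entries are the same relations at special elements: \<open>x_{ap} x_m = x_{am}\<close> at
  \<open>m = a' p\<close>, and \<open>x_m x_{pb'} = x_{mb'}\<close> at
  \<open>m = p b\<close>.\<close>

lemma rho_matrix_hom: "rho_matrix A B M p \<in> ring_hom (triangular_ring A B M) (matrix2_ring T)"
proof (rule ring_hom_memI)
  have rho_A_mult: "\<rho> (a \<otimes>\<^bsub>A\<^esub> a' \<odot>\<^bsub>M\<^esub> p) = \<rho> (a \<odot>\<^bsub>M\<^esub> p) \<otimes>\<^bsub>T\<^esub> \<rho> (a' \<odot>\<^bsub>M\<^esub> p)"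
    if "a \<in> carrier A" "a' \<in> carrier A" for a a'
    using that by (simp add: rho_smult_mult lsmult_assoc lsmult_closed)
  have rho_B_mult: "\<rho> (p \<triangleleft>\<^bsub>M\<^esub> (b \<otimes>\<^bsub>B\<^esub> b')) = \<rho> (p \<triangleleft>\<^bsub>M\<^esub> b) \<otimes>\<^bsub>T\<^esub> \<rho> (p \<triangleleft>\<^bsub>M\<^esub> b')"
    if "b \<in> carrier B" "b' \<in> carrier B" for b b'
    using that by (simp add: rho_mult_rsmult rsmult_assoc rsmult_closed)
  fix r assume "r \<in> carrier (triangular_ring A B M)"
  then obtain a m b where r: "r = (a, m, b)" "a \<in> carrier A" "m \<in> carrier M" "b \<in> carrier B"
    by auto
  then show "rho_matrix A B M p r \<in> carrier (matrix2_ring T)"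
    by (simp add: rho_matrix_def rho_A_def rho_B_def lsmult_closed rsmult_closed)
  fix r' assume "r' \<in> carrier (triangular_ring A B M)"
  then obtain a' m' b' where r': "r' = (a', m', b')" "a' \<in> carrier A" "m' \<in> carrier M" "b' \<in> carrier B"
    by auto
  show "rho_matrix A B M p (r \<otimes>\<^bsub>triangular_ring A B M\<^esub> r') =
      rho_matrix A B M p r \<otimes>\<^bsub>matrix2_ring T\<^esub> rho_matrix A B M p r'"
    using r r' by (simp add: rho_matrix_def rho_A_def rho_B_def rho_A_mult rho_B_mult rho_add
        rho_smult_mult rho_mult_rsmult lsmult_closed rsmult_closed)
  show "rho_matrix A B M p (r \<oplus>\<^bsub>triangular_ring A B M\<^esub> r') =
      rho_matrix A B M p r \<oplus>\<^bsub>matrix2_ring T\<^esub> rho_matrix A B M p r'"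
    using r r' by (simp add: rho_matrix_def rho_A_def rho_B_def rho_add lsmult_closed rsmult_closed
        lsmult_l_distr rsmult_r_distr)
next
  show "rho_matrix A B M p \<one>\<^bsub>triangular_ring A B M\<^esub> = \<one>\<^bsub>matrix2_ring T\<^esub>"
    by (simp add: rho_matrix_def rho_A_def rho_B_def lsmult_one rsmult_one)
qed

text \<open>As \<open>\<rho> p\<close> is 1, the second equation at \<open>m = p\<close> gives the
  matrix unit at (1,2). Thus the units at (1,1), (1,2) and (2,2) come from the triangular
  ring.\<close>

lemma rho_matrix_units:
  "rho_matrix A B M p (\<one>\<^bsub>A\<^esub>, \<zero>\<^bsub>M\<^esub>, \<zero>\<^bsub>B\<^esub>) = (\<one>\<^bsub>T\<^esub>, \<zero>\<^bsub>T\<^esub>, \<zero>\<^bsub>T\<^esub>, \<zero>\<^bsub>T\<^esub>)"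
  "m \<in> carrier M \<Longrightarrow> rho_matrix A B M p (\<zero>\<^bsub>A\<^esub>, m, \<zero>\<^bsub>B\<^esub>) = (\<zero>\<^bsub>T\<^esub>, \<rho> m, \<zero>\<^bsub>T\<^esub>, \<zero>\<^bsub>T\<^esub>)"
  "rho_matrix A B M p (\<zero>\<^bsub>A\<^esub>, \<zero>\<^bsub>M\<^esub>, \<one>\<^bsub>B\<^esub>) = (\<zero>\<^bsub>T\<^esub>, \<zero>\<^bsub>T\<^esub>, \<zero>\<^bsub>T\<^esub>, \<one>\<^bsub>T\<^esub>)"
  by (simp_all add: rho_matrix_def rho_A_def rho_B_def lsmult_one rsmult_one)

lemma sigma_inverting_rho_matrix:
  assumes \<sigma>: "\<sigma> \<in> left_module_hom (triangular_ring A B M) (column1 A) (column2 B M)"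
    and p: "\<sigma> \<one>\<^bsub>A\<^esub> = (p, \<zero>\<^bsub>B\<^esub>)"
  shows "sigma_inverting (triangular_ring A B M) (column1 A) (column2 B M) \<sigma>
    (matrix2_ring T) (rho_matrix A B M p)"
  by (rule sigma_inverting_iff[OF T.ring_matrix2_ring rho_matrix_hom \<sigma> p, THEN iffD2],
      rule bexI[of _ "(\<zero>\<^bsub>T\<^esub>, \<zero>\<^bsub>T\<^esub>, \<one>\<^bsub>T\<^esub>, \<zero>\<^bsub>T\<^esub>)"])
    (simp_all add: rho_matrix_units)

lemma rho_matrix_factorization:
  fixes S :: "('s, 'w) ring_scheme"
  assumes S: "ring S" and g: "g \<in> ring_hom (triangular_ring A B M) S"
    and \<sigma>: "\<sigma> \<in> left_module_hom (triangular_ring A B M) (column1 A) (column2 B M)"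
    and p: "\<sigma> \<one>\<^bsub>A\<^esub> = (p, \<zero>\<^bsub>B\<^esub>)"
    and inv: "sigma_inverting (triangular_ring A B M) (column1 A) (column2 B M) \<sigma> S g"
  shows "\<exists>!h. h \<in> ring_hom (matrix2_ring T) S \<inter> extensional (carrier (matrix2_ring T)) \<and>
    (\<forall>r\<in>carrier (triangular_ring A B M). h (rho_matrix A B M p r) = g r)"
proof -
  interpret S: ring S by (rule S)
  let ?R = "triangular_ring A B M"
  define e where "e = g (\<one>\<^bsub>A\<^esub>, \<zero>\<^bsub>M\<^esub>, \<zero>\<^bsub>B\<^esub>)"
  define f where "f = g (\<zero>\<^bsub>A\<^esub>, \<zero>\<^bsub>M\<^esub>, \<one>\<^bsub>B\<^esub>)"
  define gM where "gM m = g (\<zero>\<^bsub>A\<^esub>, m, \<zero>\<^bsub>B\<^esub>)" for m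
  define gA where "gA a = g (a, \<zero>\<^bsub>M\<^esub>, \<zero>\<^bsub>B\<^esub>)" for a
  define gB where "gB b = g (\<zero>\<^bsub>A\<^esub>, \<zero>\<^bsub>M\<^esub>, b)" for b
  note g_mult = ring_hom_mult[OF g, symmetric]
  obtain u where u: "u \<in> carrier S" "u \<otimes>\<^bsub>S\<^esub> e = u" "f \<otimes>\<^bsub>S\<^esub> u = u"
    and pu: "gM p \<otimes>\<^bsub>S\<^esub> u = e" and up: "u \<otimes>\<^bsub>S\<^esub> gM p = f"
    using inv unfolding sigma_inverting_iff[OF S g \<sigma> p] e_def f_def gM_def
    by (elim bexE conjE)
  have closed: "e \<in> carrier S" "f \<in> carrier S"
    "\<And>a. a \<in> carrier A \<Longrightarrow> gA a \<in> carrier S" "\<And>m. m \<in> carrier M \<Longrightarrow> gM m \<in> carrier S"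
    "\<And>b. b \<in> carrier B \<Longrightarrow> gB b \<in> carrier S"
    unfolding e_def f_def gA_def gM_def gB_def by (simp_all add: ring_hom_closed[OF g])
  have g_zero: "g (\<zero>\<^bsub>A\<^esub>, \<zero>\<^bsub>M\<^esub>, \<zero>\<^bsub>B\<^esub>) = \<zero>\<^bsub>S\<^esub>"
    using ring_hom_add[OF g, of "(\<zero>\<^bsub>A\<^esub>, \<zero>\<^bsub>M\<^esub>, \<zero>\<^bsub>B\<^esub>)" "(\<zero>\<^bsub>A\<^esub>, \<zero>\<^bsub>M\<^esub>, \<zero>\<^bsub>B\<^esub>)"]
      ring_hom_closed[OF g, of "(\<zero>\<^bsub>A\<^esub>, \<zero>\<^bsub>M\<^esub>, \<zero>\<^bsub>B\<^esub>)"] by simp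
  have idem: "e \<oplus>\<^bsub>S\<^esub> f = \<one>\<^bsub>S\<^esub>" "e \<otimes>\<^bsub>S\<^esub> f = \<zero>\<^bsub>S\<^esub>" "f \<otimes>\<^bsub>S\<^esub> e = \<zero>\<^bsub>S\<^esub>" "e \<otimes>\<^bsub>S\<^esub> e = e"
    using ring_hom_add[OF g, of "(\<one>\<^bsub>A\<^esub>, \<zero>\<^bsub>M\<^esub>, \<zero>\<^bsub>B\<^esub>)" "(\<zero>\<^bsub>A\<^esub>, \<zero>\<^bsub>M\<^esub>, \<one>\<^bsub>B\<^esub>)"] ring_hom_one[OF g]
    by (simp_all add: e_def f_def g_mult g_zero)
  have eM: "e \<otimes>\<^bsub>S\<^esub> gM m = gM m" and Mf: "gM m \<otimes>\<^bsub>S\<^esub> f = gM m" if "m \<in> carrier M" for m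
    using that by (simp_all add: e_def f_def gM_def g_mult lsmult_one rsmult_one)
  have gA_gM: "gA a \<otimes>\<^bsub>S\<^esub> gM m = gM (a \<odot>\<^bsub>M\<^esub> m)" if "a \<in> carrier A" "m \<in> carrier M" for a m
    using that by (simp add: gA_def gM_def g_mult lsmult_closed)
  have gM_gB: "gM m \<otimes>\<^bsub>S\<^esub> gB b = gM (m \<triangleleft>\<^bsub>M\<^esub> b)" if "b \<in> carrier B" "m \<in> carrier M" for b m
    using that by (simp add: gB_def gM_def g_mult rsmult_closed)
  have fB: "f \<otimes>\<^bsub>S\<^esub> gB b = gB b" if "b \<in> carrier B" for b
    using that by (simp add: gB_def f_def g_mult)
  have Ae: "gA a \<otimes>\<^bsub>S\<^esub> e = gA a" if "a \<in> carrier A" for a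
    using that by (simp add: gA_def e_def g_mult)
  have gM_add: "gM (m \<oplus>\<^bsub>M\<^esub> m') = gM m \<oplus>\<^bsub>S\<^esub> gM m'" if "m \<in> carrier M" "m' \<in> carrier M" for m m'
    using that ring_hom_add[OF g, of "(\<zero>\<^bsub>A\<^esub>, m, \<zero>\<^bsub>B\<^esub>)" "(\<zero>\<^bsub>A\<^esub>, m', \<zero>\<^bsub>B\<^esub>)"] by (simp add: gM_def)
  have g_sum: "g (a, m, b) = gA a \<oplus>\<^bsub>S\<^esub> gM m \<oplus>\<^bsub>S\<^esub> gB b"
    if "a \<in> carrier A" "m \<in> carrier M" "b \<in> carrier B" for a m b
    using that ring_hom_add[OF g, of "(a, \<zero>\<^bsub>M\<^esub>, \<zero>\<^bsub>B\<^esub>)" "(\<zero>\<^bsub>A\<^esub>, m, \<zero>\<^bsub>B\<^esub>)"]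
      ring_hom_add[OF g, of "(a, m, \<zero>\<^bsub>B\<^esub>)" "(\<zero>\<^bsub>A\<^esub>, \<zero>\<^bsub>M\<^esub>, b)"]
    by (simp add: gA_def gM_def gB_def)
  \<comment> \<open>The factor \<open>u w = f\<close> is absorbed by \<open>gM m\<close>; the
    trailing \<open>s\<close> fits products nested to the right.\<close>
  have Mup: "gM m \<otimes>\<^bsub>S\<^esub> (u \<otimes>\<^bsub>S\<^esub> (gM p \<otimes>\<^bsub>S\<^esub> s)) = gM m \<otimes>\<^bsub>S\<^esub> s"
    if "m \<in> carrier M" "s \<in> carrier S" for m s
  proof -
    have "gM m \<otimes>\<^bsub>S\<^esub> (u \<otimes>\<^bsub>S\<^esub> (gM p \<otimes>\<^bsub>S\<^esub> s)) = gM m \<otimes>\<^bsub>S\<^esub> (u \<otimes>\<^bsub>S\<^esub> gM p) \<otimes>\<^bsub>S\<^esub> s"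
      using that u closed by (simp add: S.m_assoc)
    with that show ?thesis by (simp add: up Mf)
  qed

  obtain \<theta> where \<theta>: "\<theta> \<in> ring_hom T (corner_ring S e)"
    and \<theta>_rho: "\<And>m. m \<in> carrier M \<Longrightarrow> \<theta> (\<rho> m) = gM m \<otimes>\<^bsub>S\<^esub> u"
  proof (rule T_universal[OF S.ring_corner_ring[OF closed(1) idem(4)]])
    show "(\<lambda>m. gM m \<otimes>\<^bsub>S\<^esub> u) \<in> carrier M \<rightarrow> carrier (corner_ring S e)"
      using u closed by (auto simp: S.m_assoc) (simp add: S.m_assoc[symmetric] eM)
    fix m assume m: "m \<in> carrier M"
    show "gM (m \<oplus>\<^bsub>M\<^esub> m') \<otimes>\<^bsub>S\<^esub> u = gM m \<otimes>\<^bsub>S\<^esub> u \<oplus>\<^bsub>corner_ring S e\<^esub> gM m' \<otimes>\<^bsub>S\<^esub> u"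
      if "m' \<in> carrier M" for m'
      using u m that closed by (simp add: gM_add S.l_distr)
    show "gM (a \<odot>\<^bsub>M\<^esub> p) \<otimes>\<^bsub>S\<^esub> u \<otimes>\<^bsub>corner_ring S e\<^esub> (gM m \<otimes>\<^bsub>S\<^esub> u) = gM (a \<odot>\<^bsub>M\<^esub> m) \<otimes>\<^bsub>S\<^esub> u"
      if a: "a \<in> carrier A" for a
    proof -
      \<comment> \<open>\<open>gM (a p) u = gA a w u = gA a e\<close>: the copy of \<open>A\<close>
        in the corner is the restriction of \<open>g\<close>.\<close>
      have "gM (a \<odot>\<^bsub>M\<^esub> p) \<otimes>\<^bsub>S\<^esub> u = gA a"
        using a u closed gA_gM[OF a p_closed, symmetric] by (simp add: S.m_assoc pu Ae)
      then show ?thesis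
        using a u m closed by (simp add: gA_gM[symmetric] S.m_assoc)
    qed
    \<comment> \<open>After \<open>gM (p b)\<close> is split as \<open>w gB b\<close>, this is
      \<open>Mup\<close> with \<open>s = gB b u\<close>.\<close>
    show "gM m \<otimes>\<^bsub>S\<^esub> u \<otimes>\<^bsub>corner_ring S e\<^esub> (gM (p \<triangleleft>\<^bsub>M\<^esub> b) \<otimes>\<^bsub>S\<^esub> u) = gM (m \<triangleleft>\<^bsub>M\<^esub> b) \<otimes>\<^bsub>S\<^esub> u"
      if b: "b \<in> carrier B" for b
      using b u m closed by (simp add: gM_gB[symmetric] S.m_assoc Mup)
  next
    show "gM p \<otimes>\<^bsub>S\<^esub> u = \<one>\<^bsub>corner_ring S e\<^esub>"
      by (simp add: pu)
  qed (rule that)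
  interpret \<theta>: ring_hom_ring T "corner_ring S e" \<theta>
    by (intro ring_hom_ringI2 T.ring_axioms S.ring_corner_ring closed(1) idem(4) \<theta>)
  have \<theta>_closed: "\<theta> t \<in> carrier S" if "t \<in> carrier T" for t
    using \<theta>.hom_closed[OF that] by simp_all

  define H where "H = (\<lambda>(x, y, z, t). \<theta> x \<oplus>\<^bsub>S\<^esub> \<theta> y \<otimes>\<^bsub>S\<^esub> gM p \<oplus>\<^bsub>S\<^esub> u \<otimes>\<^bsub>S\<^esub> \<theta> z \<oplus>\<^bsub>S\<^esub> u \<otimes>\<^bsub>S\<^esub> \<theta> t \<otimes>\<^bsub>S\<^esub> gM p)"
  have H_hom: "H \<in> ring_hom (matrix2_ring T) S"
    unfolding H_def
    by (rule T.matrix2_ring_hom[OF S closed(1,2) u(1) closed(4)[OF p_closed] idem(1-3) u(2,3)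
          eM[OF p_closed] Mf[OF p_closed] pu up \<theta>])
  have H_rho: "H (rho_matrix A B M p r) = g r" if r_closed: "r \<in> carrier ?R" for r
  proof -
    obtain a m b where r: "r = (a, m, b)" "a \<in> carrier A" "m \<in> carrier M" "b \<in> carrier B"
      using r_closed by auto
    have "gM (a \<odot>\<^bsub>M\<^esub> p) \<otimes>\<^bsub>S\<^esub> u = gA a"
      using r u closed gA_gM[OF r(2) p_closed, symmetric] by (simp add: S.m_assoc pu Ae)
    moreover have "gM m \<otimes>\<^bsub>S\<^esub> u \<otimes>\<^bsub>S\<^esub> gM p = gM m"
      using r u closed by (simp add: S.m_assoc up Mf)
    \<comment> \<open>The corner sees \<open>b\<close> as \<open>w gB b u\<close>; conjugating by
      \<open>u\<close> and \<open>w\<close> returns it to the corner at \<open>f\<close>.\<close>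
    moreover have "u \<otimes>\<^bsub>S\<^esub> (gM (p \<triangleleft>\<^bsub>M\<^esub> b) \<otimes>\<^bsub>S\<^esub> u) \<otimes>\<^bsub>S\<^esub> gM p = gB b"
    proof -
      have "u \<otimes>\<^bsub>S\<^esub> (gM (p \<triangleleft>\<^bsub>M\<^esub> b) \<otimes>\<^bsub>S\<^esub> u) \<otimes>\<^bsub>S\<^esub> gM p =
          (u \<otimes>\<^bsub>S\<^esub> gM p) \<otimes>\<^bsub>S\<^esub> (gB b \<otimes>\<^bsub>S\<^esub> (u \<otimes>\<^bsub>S\<^esub> gM p))"
        using r u closed by (simp add: S.m_assoc gM_gB[symmetric])
      also have "\<dots> = f \<otimes>\<^bsub>S\<^esub> (gB b \<otimes>\<^bsub>S\<^esub> f)"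
        by (simp only: up)
      also have "gB b \<otimes>\<^bsub>S\<^esub> f = gB b"
        using r by (simp add: gB_def f_def g_mult)
      finally show ?thesis
        using r by (simp add: fB)
    qed
    ultimately show ?thesis
      using r u closed by (simp add: H_def rho_matrix_def rho_A_def rho_B_def \<theta>_rho lsmult_closed
          rsmult_closed g_sum)
  qed

  have unique: "h X = H X"
    if h: "h \<in> ring_hom (matrix2_ring T) S" and h_rho: "\<And>r. r \<in> carrier ?R \<Longrightarrow> h (rho_matrix A B M p r) = g r"
      and X: "X \<in> carrier (matrix2_ring T)" for h X
  proof -
    define E11 where "E11 t = (t, \<zero>\<^bsub>T\<^esub>, \<zero>\<^bsub>T\<^esub>, \<zero>\<^bsub>T\<^esub>)" for t :: "('m list \<Rightarrow>\<^sub>0 int) set"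
    define E12 where "E12 t = (\<zero>\<^bsub>T\<^esub>, t, \<zero>\<^bsub>T\<^esub>, \<zero>\<^bsub>T\<^esub>)" for t :: "('m list \<Rightarrow>\<^sub>0 int) set"
    define E21 where "E21 = (\<zero>\<^bsub>T\<^esub>, \<zero>\<^bsub>T\<^esub>, \<one>\<^bsub>T\<^esub>, \<zero>\<^bsub>T\<^esub>)"
    define E22 where "E22 = (\<zero>\<^bsub>T\<^esub>, \<zero>\<^bsub>T\<^esub>, \<zero>\<^bsub>T\<^esub>, \<one>\<^bsub>T\<^esub>)"
    note E_defs = E11_def E12_def E21_def E22_def
    have E_closed: "t \<in> carrier T \<Longrightarrow> E11 t \<in> carrier (matrix2_ring T)"
      "t \<in> carrier T \<Longrightarrow> E12 t \<in> carrier (matrix2_ring T)"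
      "E21 \<in> carrier (matrix2_ring T)" "E22 \<in> carrier (matrix2_ring T)" for t
      by (simp_all add: E_defs)
    note h_mult = ring_hom_mult[OF h, symmetric]
    have h_closed: "t \<in> carrier T \<Longrightarrow> h (E11 t) \<in> carrier S" "h E21 \<in> carrier S" for t
      by (simp_all only: ring_hom_closed[OF h] E_closed)
    have h_E: "h (E11 \<one>\<^bsub>T\<^esub>) = e" "m \<in> carrier M \<Longrightarrow> h (E12 (\<rho> m)) = gM m" "h E22 = f" for m
      using h_rho[of "(\<one>\<^bsub>A\<^esub>, \<zero>\<^bsub>M\<^esub>, \<zero>\<^bsub>B\<^esub>)"] h_rho[of "(\<zero>\<^bsub>A\<^esub>, m, \<zero>\<^bsub>B\<^esub>)"] h_rho[of "(\<zero>\<^bsub>A\<^esub>, \<zero>\<^bsub>M\<^esub>, \<one>\<^bsub>B\<^esub>)"]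
      by (simp_all add: rho_matrix_units E_defs e_def f_def gM_def)
    have hp: "h (E12 \<one>\<^bsub>T\<^esub>) = gM p"
      using h_E(2)[OF p_closed] by simp
    \<comment> \<open>Uniqueness of an inverse:
      \<open>h E21 = h E21 e = h E21 w u = f u = u\<close>, where \<open>h E21 w = f\<close> comes
      from multiplying matrix units.\<close>
    have h21: "h E21 = u"
    proof -
      have "h E21 = h E21 \<otimes>\<^bsub>S\<^esub> h (E11 \<one>\<^bsub>T\<^esub>)"
        unfolding h_mult[OF E_closed(3) E_closed(1)[OF T.one_closed]] by (simp add: E_defs)
      also have "\<dots> = h E21 \<otimes>\<^bsub>S\<^esub> h (E12 \<one>\<^bsub>T\<^esub>) \<otimes>\<^bsub>S\<^esub> u"
        using u closed h_closed(2) by (simp add: h_E(1) hp pu[symmetric] S.m_assoc)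
      also have "h E21 \<otimes>\<^bsub>S\<^esub> h (E12 \<one>\<^bsub>T\<^esub>) = f"
        unfolding h_mult[OF E_closed(3) E_closed(2)[OF T.one_closed]] h_E(3)[symmetric]
        by (simp add: E_defs)
      finally show ?thesis
        by (simp add: u)
    qed
    \<comment> \<open>\<open>E11\<close> preserves sums and products, so agreement on generators
      suffices; there \<open>E11 (\<rho> m)\<close> factors as \<open>E12 (\<rho> m)\<close> times
      \<open>E21\<close>, whose images are already known.\<close>
    have h11: "h (E11 t) = \<theta> t" if "t \<in> carrier T" for t
      using that
    proof (induction rule: T_induct)
      case one
      then show ?case using h_E(1) \<theta>.hom_one by simp
    next
      case (rho m)
      have "h (E11 (\<rho> m)) = h (E12 (\<rho> m)) \<otimes>\<^bsub>S\<^esub> h E21"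
        unfolding h_mult[OF E_closed(2)[OF rho_closed[OF rho]] E_closed(3)]
        using rho by (simp add: E_defs)
      with rho show ?case
        by (simp add: h_E(2) h21 \<theta>_rho)
    next
      case (mult s t)
      have "h (E11 (s \<otimes>\<^bsub>T\<^esub> t)) = h (E11 s) \<otimes>\<^bsub>S\<^esub> h (E11 t)"
        unfolding h_mult[OF E_closed(1)[OF mult(1)] E_closed(1)[OF mult(2)]]
        using mult(1,2) by (simp add: E_defs)
      also have "\<dots> = \<theta> (s \<otimes>\<^bsub>T\<^esub> t)"
        using mult \<theta>.hom_mult[OF mult(1,2)] by simp
      finally show ?case .
    next
      case (diff s t)
      note st = T.minus_closed[OF diff(1,2)]
      \<comment> \<open>Since \<open>h\<close> and \<theta> respect sums, the difference is compared
        after adding \<open>t\<close> back, and the common summand cancels.\<close>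
      have s: "s \<ominus>\<^bsub>T\<^esub> t \<oplus>\<^bsub>T\<^esub> t = s"
        using diff(1,2) by (simp add: a_minus_def T.a_assoc T.l_neg)
      have "h (E11 (s \<ominus>\<^bsub>T\<^esub> t)) \<oplus>\<^bsub>S\<^esub> h (E11 t) = h (E11 (s \<ominus>\<^bsub>T\<^esub> t \<oplus>\<^bsub>T\<^esub> t))"
        unfolding ring_hom_add[OF h E_closed(1)[OF st] E_closed(1)[OF diff(2)], symmetric]
        by (simp add: E_defs)
      also have "\<dots> = \<theta> (s \<ominus>\<^bsub>T\<^esub> t \<oplus>\<^bsub>T\<^esub> t)"
        unfolding s by (rule diff)
      also have "\<dots> = \<theta> (s \<ominus>\<^bsub>T\<^esub> t) \<oplus>\<^bsub>S\<^esub> h (E11 t)"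
        using \<theta>.hom_add[OF st diff(2)] diff(4) by simp
      finally show ?case
        using h_closed(1)[OF st] \<theta>_closed[OF st] h_closed(1)[OF diff(2)] by simp
    qed
    obtain x y z t where xyzt: "X = (x, y, z, t)"
      "x \<in> carrier T" "y \<in> carrier T" "z \<in> carrier T" "t \<in> carrier T"
      using X by auto
    let ?Mat = "matrix2_ring T"
    interpret Mat: ring ?Mat by (rule T.ring_matrix2_ring)
    note E' = E_closed(1)[OF xyzt(2)] E_closed(1)[OF xyzt(3)] E_closed(1)[OF xyzt(4)]
      E_closed(1)[OF xyzt(5)] E_closed(2)[OF T.one_closed] E_closed(3)
    \<comment> \<open>The decomposition mirrors the formula for \<open>H\<close> term by term, so
      that applying \<open>h\<close> yields \<open>H X\<close>.\<close>
    have "X = E11 x \<oplus>\<^bsub>?Mat\<^esub> E11 y \<otimes>\<^bsub>?Mat\<^esub> E12 \<one>\<^bsub>T\<^esub> \<oplus>\<^bsub>?Mat\<^esub> E21 \<otimes>\<^bsub>?Mat\<^esub> E11 z \<oplus>\<^bsub>?Mat\<^esub>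
        E21 \<otimes>\<^bsub>?Mat\<^esub> E11 t \<otimes>\<^bsub>?Mat\<^esub> E12 \<one>\<^bsub>T\<^esub>"
      using xyzt by (simp add: E_defs)
    also have "h \<dots> = h (E11 x) \<oplus>\<^bsub>S\<^esub> h (E11 y) \<otimes>\<^bsub>S\<^esub> h (E12 \<one>\<^bsub>T\<^esub>) \<oplus>\<^bsub>S\<^esub> h E21 \<otimes>\<^bsub>S\<^esub> h (E11 z) \<oplus>\<^bsub>S\<^esub>
        h E21 \<otimes>\<^bsub>S\<^esub> h (E11 t) \<otimes>\<^bsub>S\<^esub> h (E12 \<one>\<^bsub>T\<^esub>)"
      by (simp only: ring_hom_add[OF h] ring_hom_mult[OF h] Mat.a_closed Mat.m_closed E')
    also have "\<dots> = H X"
      using xyzt by (simp add: H_def h11 h21 hp)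
    finally show ?thesis .
  qed

  show ?thesis
  proof (rule ex1I)
    \<comment> \<open>The image of \<open>rho_matrix\<close> lies in the carrier, so restricting
      \<open>H\<close> to make it extensional leaves the factorization intact.\<close>
    have "rho_matrix A B M p r \<in> carrier (matrix2_ring T)" if "r \<in> carrier ?R" for r
      using that by (rule ring_hom_closed[OF rho_matrix_hom])
    then show "restrict H (carrier (matrix2_ring T)) \<in>
        ring_hom (matrix2_ring T) S \<inter> extensional (carrier (matrix2_ring T)) \<and>
      (\<forall>r\<in>carrier ?R. restrict H (carrier (matrix2_ring T)) (rho_matrix A B M p r) = g r)"
      using H_rho ring.ring_hom_restrict[OF T.ring_matrix2_ring H_hom, of "restrict H (carrier (matrix2_ring T))"]
      by simp
  next
    fix h
    assume "h \<in> ring_hom (matrix2_ring T) S \<inter> extensional (carrier (matrix2_ring T)) \<and>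
      (\<forall>r\<in>carrier ?R. h (rho_matrix A B M p r) = g r)"
    then have h: "h \<in> ring_hom (matrix2_ring T) S" "h \<in> extensional (carrier (matrix2_ring T))"
      "\<And>r. r \<in> carrier ?R \<Longrightarrow> h (rho_matrix A B M p r) = g r"
      by blast+
    show "h = restrict H (carrier (matrix2_ring T))"
    proof (rule extensionalityI[OF h(2) restrict_extensional])
      fix X assume X: "X \<in> carrier (matrix2_ring T)"
      show "h X = restrict H (carrier (matrix2_ring T)) X"
        using unique[OF h(1,3) X] X by (simp only: restrict_apply if_True)
    qed
  qed
qed

end

theorem theorem2p4:
  fixes A :: "('a, 'x) ring_scheme"
    and B :: "('b, 'y) ring_scheme"
    and M :: "('a, 'b, 'm, 'z) bimodule_scheme"
    and \<sigma> :: "'a \<Rightarrow> 'm \<times> 'b"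
    and p :: 'm
  assumes "ring A" and "ring B" and "bimodule A B M"
    and "\<sigma> \<in> left_module_hom (triangular_ring A B M) (column1 A) (column2 B M)"
    and "p \<in> carrier M" and "\<sigma> \<one>\<^bsub>A\<^esub> = (p, \<zero>\<^bsub>B\<^esub>)"
  shows "universal_localization TYPE('c) (triangular_ring A B M) (column1 A) (column2 B M) \<sigma>
    (matrix2_ring (T_ring A B M p)) (rho_matrix A B M p)"
proof -
  interpret pointed_bimodule A B M p
    using assms(3,5) by (intro pointed_bimodule.intro pointed_bimodule_axioms.intro)
  show ?thesis
    unfolding universal_localization_def
  proof (intro conjI allI impI)
    show "sigma_inverting (triangular_ring A B M) (column1 A) (column2 B M) \<sigma>
        (matrix2_ring T) (rho_matrix A B M p)"
      by (rule sigma_inverting_rho_matrix[OF assms(4,6)])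
    fix S :: "'c ring" and g
    assume inv: "sigma_inverting (triangular_ring A B M) (column1 A) (column2 B M) \<sigma> S g"
    then have "ring S" "g \<in> ring_hom (triangular_ring A B M) S"
      unfolding sigma_inverting_def by simp_all
    then show "\<exists>!h. h \<in> ring_hom (matrix2_ring T) S \<inter> extensional (carrier (matrix2_ring T)) \<and>
        (\<forall>r\<in>carrier (triangular_ring A B M). h (rho_matrix A B M p r) = g r)"
      by (rule rho_matrix_factorization[OF _ _ assms(4,6) inv])
  qed
qed

end
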